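(* Let $E$ and $F$ be directed graphs, and let $R$ be a subring of $\mathbb{C}$ that is closed under complex conjugation, contains $1$ and is kind. If $\pi:L_R(E)\to L_R(F)$ is a $*$-algebra homomorphism, then $\pi(D_R(E))\subseteq D_R(F)$.
   Context: **Kind rings.** A subring $R$ of $\mathbb{C}$ that is closed under complex conjugation and contains $1$ is called kind if whenever $\lambda_0,\lambda_1,\dots,\lambda_n\in R$ satisfy $\lambda_0=\sum_{i=0}^n|\lambda_i|^2$, then $\lambda_1=\dots=\lambda_n=0$. **Directed graphs.** A directed graph is a quadruple $E=(E^0,E^1,s,r)$ where $E^0$ and $E^1$ are (arbitrary) sets and $s,r:E^1\to E^0$ are maps. A path of length $n\ge 1$ is a sequence of edges $\mu=\mu_1\cdots\mu_n$ with $r(\mu_i)=s(\mu_{i+1})$ for $1\le i\le n-1$; set $|\mu|=n$, $s(\mu)=s(\mu_1)$, $r(\mu)=r(\mu_n)$. Vertices $v\in E^0$ are regarded as paths of length $0$ with $s(v)=r(v)=v$. $E^n$ is the set of paths of length $n$, $E^*=\bigcup_{n\ge 0}E^n$, and $vE^1$ is the set of edges with source $v$. Put $E^0_{\mathrm{reg}}=\{v\in E^0: vE^1\text{ is finite and nonempty}\}$. **Leavitt path algebras.** For a subring $R$ of $\mathbb{C}$ that is closed under complex conjugation and contains $1$, $L_R(E)$ is the universal (associative, not necessarily unital) $R$-algebra generated by pairwise orthogonal idempotents $\{v:v\in E^0\}$ and elements $\{e,e^*:e\in E^1\}$ satisfying: (LP1) $e^*f=0$ if $e\neq f$; (LP2)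 $e^*e=r(e)$; (LP3) $s(e)e=e=er(e)$; (LP4) $e^*s(e)=e^*=r(e)e^*$; (LP5) $v=\sum_{e\in vE^1}ee^*$ if $v\in E^0_{\mathrm{reg}}$. For $\mu=\mu_1\cdots\mu_n\in E^n$, $\mu$ also denotes the product $\mu_1\cdots\mu_n\in L_R(E)$ and $\mu^*=\mu_n^*\cdots\mu_1^*$; for $v\in E^0$, $v^*=v$. Then $L_R(E)=\operatorname{span}_R\{\mu\nu^*:\mu,\nu\in E^*,\ r(\mu)=r(\nu)\}$. The assignment $\mu\nu^*\mapsto\nu\mu^*$ extends to a conjugate linear involution on $L_R(E)$, making it a $*$-algebra over $R$. The diagonal is $D_R(E)=\operatorname{span}_R\{\mu\mu^*:\mu\in E^*\}$. A $*$-algebra homomorphism is an $R$-algebra homomorphism (not required to preserve units) that preserves the involution. *)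

theory Defs
  imports Complex_Main "HOL-Library.Poly_Mapping" "Graph_Theory.Arc_Walk"
begin

section \<open>Coefficient rings\<close>

definition conj_subring :: "complex set \<Rightarrow> bool" where
  "conj_subring R \<longleftrightarrow>
     1 \<in> R \<and> (\<forall>x\<in>R. \<forall>y\<in>R. x - y \<in> R \<and> x * y \<in> R) \<and> (\<forall>x\<in>R. cnj x \<in> R)"

definition kind :: "complex set \<Rightarrow> bool" where
  "kind R \<longleftrightarrow>
     (\<forall>(n::nat) (l::nat \<Rightarrow> complex).
        (\<forall>i\<le>n. l i \<in> R) \<and> l 0 = of_real (\<Sum>i\<le>n. (cmod (l i))\<^sup>2) \<longrightarrow>
        (\<forall>i\<in>{1..n}. l i = 0))"


section \<open>Star algebras with explicit carriers, not necessarily unital\<close>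

record 'a star_algebra =
  carr :: "'a set"
  zer :: 'a
  add :: "'a \<Rightarrow> 'a \<Rightarrow> 'a"
  scl :: "complex \<Rightarrow> 'a \<Rightarrow> 'a"
  mul :: "'a \<Rightarrow> 'a \<Rightarrow> 'a"
  str :: "'a \<Rightarrow> 'a"

definition star_algebra_hom ::
  "complex set \<Rightarrow> 'a star_algebra \<Rightarrow> 'b star_algebra \<Rightarrow> ('a \<Rightarrow> 'b) \<Rightarrow> bool" where
  "star_algebra_hom R A B f \<longleftrightarrow>
     (\<forall>x\<in>carr A. f x \<in> carr B) \<and>
     (\<forall>x\<in>carr A. \<forall>y\<in>carr A. f (add A x y) = add B (f x) (f y)) \<and>
     (\<forall>c\<in>R. \<forall>x\<in>carr A. f (scl A c x) = scl B c (f x)) \<and>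
     (\<forall>x\<in>carr A. \<forall>y\<in>carr A. f (mul A x y) = mul B (f x) (f y)) \<and>
     (\<forall>x\<in>carr A. f (str A x) = str B (f x))"

inductive_set lin_span :: "complex set \<Rightarrow> 'a star_algebra \<Rightarrow> 'a set \<Rightarrow> 'a set"
  for R :: "complex set" and A :: "'a star_algebra" and S :: "'a set" where
  zer: "zer A \<in> lin_span R A S"
| step: "c \<in> R \<Longrightarrow> s \<in> S \<Longrightarrow> x \<in> lin_span R A S \<Longrightarrow> add A (scl A c s) x \<in> lin_span R A S"


section \<open>Words and the free algebra\<close>

datatype ('v, 'e) gen = Vert 'v | Edge 'e | Ghost 'e

text \<open>
  A copy of the type of lists, so that concatenation can be declared as the monoid operation that
  the convolution product of \<^type>\<open>poly_mapping\<close> refers to.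
\<close>

datatype ('v, 'e) word = Word (letters: "('v, 'e) gen list")

instantiation word :: (type, type) monoid_add
begin

definition zero_word :: "('a, 'b) word" where
  "0 = Word []"

definition plus_word :: "('a, 'b) word \<Rightarrow> ('a, 'b) word \<Rightarrow> ('a, 'b) word" where
  "a + b = Word (letters a @ letters b)"

instance
  by standard (simp_all add: zero_word_def plus_word_def)

end

type_synonym ('v, 'e) free_alg = "('v, 'e) word \<Rightarrow>\<^sub>0 complex"

definition mon :: "('v, 'e) gen list \<Rightarrow> ('v, 'e) free_alg" where
  "mon xs = Poly_Mapping.single (Word xs) 1"

definition scale :: "complex \<Rightarrow> ('v, 'e) free_alg \<Rightarrow> ('v, 'e) free_alg" where
  "scale c p = Poly_Mapping.single 0 c * p"

definition gens :: "('v, 'e) pre_digraph \<Rightarrow> ('v, 'e) gen set" where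
  "gens E = Vert ` verts E \<union> Edge ` arcs E \<union> Ghost ` arcs E"

text \<open>
  The free non-unital \<open>R\<close>-algebra on \<^term>\<open>gens E\<close>: the empty word must not occur.
\<close>

definition free :: "complex set \<Rightarrow> ('v, 'e) pre_digraph \<Rightarrow> ('v, 'e) free_alg set" where
  "free R E = {p. \<forall>w\<in>Poly_Mapping.keys p.
     letters w \<noteq> [] \<and> set (letters w) \<subseteq> gens E \<and> Poly_Mapping.lookup p w \<in> R}"

fun gen_star :: "('v, 'e) gen \<Rightarrow> ('v, 'e) gen" where
  "gen_star (Vert v) = Vert v"
| "gen_star (Edge e) = Ghost e"
| "gen_star (Ghost e) = Edge e"

definition word_star :: "('v, 'e) word \<Rightarrow> ('v, 'e) word" where
  "word_star w = Word (rev (map gen_star (letters w)))"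

definition free_star :: "('v, 'e) free_alg \<Rightarrow> ('v, 'e) free_alg" where
  "free_star p =
     (\<Sum>w\<in>Poly_Mapping.keys p. Poly_Mapping.single (word_star w) (cnj (Poly_Mapping.lookup p w)))"


section \<open>Leavitt path algebras\<close>

definition regular :: "('v, 'e) pre_digraph \<Rightarrow> 'v \<Rightarrow> bool" where
  "regular E v \<longleftrightarrow> v \<in> verts E \<and> finite (out_arcs E v) \<and> out_arcs E v \<noteq> {}"

text \<open>Differences of the two sides of the defining relations.\<close>

inductive_set relators :: "('v, 'e) pre_digraph \<Rightarrow> ('v, 'e) free_alg set"
  for E :: "('v, 'e) pre_digraph" where
  idem: "v \<in> verts E \<Longrightarrow> mon [Vert v, Vert v] - mon [Vert v] \<in> relators E"
| orth: "v \<in> verts E \<Longrightarrow> w \<in> verts E \<Longrightarrow> v \<noteq> w \<Longrightarrow> mon [Vert v, Vert w] \<in> relators E"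
| LP1: "e \<in> arcs E \<Longrightarrow> f \<in> arcs E \<Longrightarrow> e \<noteq> f \<Longrightarrow> mon [Ghost e, Edge f] \<in> relators E"
| LP2: "e \<in> arcs E \<Longrightarrow> mon [Ghost e, Edge e] - mon [Vert (head E e)] \<in> relators E"
| LP3_source: "e \<in> arcs E \<Longrightarrow> mon [Vert (tail E e), Edge e] - mon [Edge e] \<in> relators E"
| LP3_range: "e \<in> arcs E \<Longrightarrow> mon [Edge e, Vert (head E e)] - mon [Edge e] \<in> relators E"
| LP4_source: "e \<in> arcs E \<Longrightarrow> mon [Ghost e, Vert (tail E e)] - mon [Ghost e] \<in> relators E"
| LP4_range: "e \<in> arcs E \<Longrightarrow> mon [Vert (head E e), Ghost e] - mon [Ghost e] \<in> relators E"
| LP5: "regular E v \<Longrightarrow>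
    mon [Vert v] - (\<Sum>e\<in>out_arcs E v. mon [Edge e, Ghost e]) \<in> relators E"

inductive_set rel_ideal :: "complex set \<Rightarrow> ('v, 'e) pre_digraph \<Rightarrow> ('v, 'e) free_alg set"
  for R :: "complex set" and E :: "('v, 'e) pre_digraph" where
  zero: "0 \<in> rel_ideal R E"
| base: "x \<in> relators E \<Longrightarrow> x \<in> rel_ideal R E"
| add: "x \<in> rel_ideal R E \<Longrightarrow> y \<in> rel_ideal R E \<Longrightarrow> x + y \<in> rel_ideal R E"
| scale: "c \<in> R \<Longrightarrow> x \<in> rel_ideal R E \<Longrightarrow> scale c x \<in> rel_ideal R E"
| mult_left: "a \<in> free R E \<Longrightarrow> x \<in> rel_ideal R E \<Longrightarrow> a * x \<in> rel_ideal R E"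
| mult_right: "a \<in> free R E \<Longrightarrow> x \<in> rel_ideal R E \<Longrightarrow> x * a \<in> rel_ideal R E"

definition cls ::
  "complex set \<Rightarrow> ('v, 'e) pre_digraph \<Rightarrow> ('v, 'e) free_alg \<Rightarrow> ('v, 'e) free_alg set" where
  "cls R E x = {y \<in> free R E. y - x \<in> rel_ideal R E}"

text \<open>
  The quotient of the free algebra by the relations. The operations take all representatives;
  the lemmas \<open>leavitt_*\<close> below show that they do not depend on the choice. The involution is the
  conjugate linear anti-automorphism with \<open>v \<mapsto> v\<close>, \<open>e \<mapsto> e\<^sup>*\<close> and \<open>e\<^sup>* \<mapsto> e\<close>; by
  \<open>leavitt_star_path_ghost\<close> it sends \<open>\<mu>\<nu>\<^sup>*\<close> to \<open>\<nu>\<mu>\<^sup>*\<close>.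
\<close>

definition leavitt ::
  "complex set \<Rightarrow> ('v, 'e) pre_digraph \<Rightarrow> ('v, 'e) free_alg set star_algebra" where
  "leavitt R E = \<lparr>
     carr = cls R E ` free R E,
     zer = cls R E 0,
     add = (\<lambda>A B. \<Union>a\<in>A. \<Union>b\<in>B. cls R E (a + b)),
     scl = (\<lambda>c A. \<Union>a\<in>A. cls R E (scale c a)),
     mul = (\<lambda>A B. \<Union>a\<in>A. \<Union>b\<in>B. cls R E (a * b)),
     str = (\<lambda>A. \<Union>a\<in>A. cls R E (free_star a))\<rparr>"

text \<open>
  A path is given by its source \<open>v\<close> and its list of edges, as in \<^const>\<open>pre_digraph.awalk\<close>;
  the path of length 0 at \<open>v\<close> is \<open>(v, [])\<close>.
\<close>

definition path_word :: "'v \<Rightarrow> 'e list \<Rightarrow> ('v, 'e) gen list" where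
  "path_word v p = (if p = [] then [Vert v] else map Edge p)"

definition path_elt ::
  "complex set \<Rightarrow> ('v, 'e) pre_digraph \<Rightarrow> 'v \<Rightarrow> 'e list \<Rightarrow> ('v, 'e) free_alg set" where
  "path_elt R E v p = cls R E (mon (path_word v p))"

definition diagonal ::
  "complex set \<Rightarrow> ('v, 'e) pre_digraph \<Rightarrow> ('v, 'e) free_alg set set" where
  "diagonal R E = lin_span R (leavitt R E)
     {mul (leavitt R E) (path_elt R E v p) (str (leavitt R E) (path_elt R E v p)) | v p w.
        pre_digraph.awalk E v p w}"


section \<open>Well-definedness\<close>

lemma conj_subringD:
  assumes "conj_subring R"
  shows "1 \<in> R" "0 \<in> R" "-1 \<in> R" "x \<in> R \<Longrightarrow> y \<in> R \<Longrightarrow> x + y \<in> R"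
    "x \<in> R \<Longrightarrow> y \<in> R \<Longrightarrow> x * y \<in> R" "x \<in> R \<Longrightarrow> cnj x \<in> R"
proof -
  have d: "x - y \<in> R" if "x \<in> R" "y \<in> R" for x y
    using assms that unfolding conj_subring_def by blast
  show 1: "1 \<in> R" using assms unfolding conj_subring_def by blast
  show 0: "0 \<in> R" using d[OF 1 1] by simp
  show "-1 \<in> R" using d[OF 0 1] by simp
  show "x + y \<in> R" if "x \<in> R" "y \<in> R"
    using d[OF that(1) d[OF 0 that(2)]] by simp
  show "x * y \<in> R" if "x \<in> R" "y \<in> R"
    using assms that unfolding conj_subring_def by blast
  show "cnj x \<in> R" if "x \<in> R"
    using assms that unfolding conj_subring_def by blast
qed

lemma free_iff:
  assumes "conj_subring R"
  shows "p \<in> free R E \<longleftrightarrow> (\<forall>w. Poly_Mapping.lookup p w \<in> R \<and>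
     (Poly_Mapping.lookup p w \<noteq> 0 \<longrightarrow> letters w \<noteq> [] \<and> set (letters w) \<subseteq> gens E))"
  using conj_subringD(2)[OF assms] by (auto simp: free_def in_keys_iff)

lemma free_zero: "conj_subring R \<Longrightarrow> 0 \<in> free R E"
  by (simp add: free_iff conj_subringD)

lemma free_add:
  assumes "conj_subring R" "p \<in> free R E" "q \<in> free R E"
  shows "p + q \<in> free R E"
  unfolding free_iff[OF assms(1)] lookup_add
proof (intro allI conjI impI)
  fix w
  have p: "Poly_Mapping.lookup p w \<in> R"
    "Poly_Mapping.lookup p w \<noteq> 0 \<Longrightarrow> letters w \<noteq> [] \<and> set (letters w) \<subseteq> gens E"
    using assms(2) unfolding free_iff[OF assms(1)] by blast+
  have q: "Poly_Mapping.lookup q w \<in> R"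
    "Poly_Mapping.lookup q w \<noteq> 0 \<Longrightarrow> letters w \<noteq> [] \<and> set (letters w) \<subseteq> gens E"
    using assms(3) unfolding free_iff[OF assms(1)] by blast+
  show "Poly_Mapping.lookup p w + Poly_Mapping.lookup q w \<in> R"
    by (rule conj_subringD(4)[OF assms(1) p(1) q(1)])
  assume "Poly_Mapping.lookup p w + Poly_Mapping.lookup q w \<noteq> 0"
  then have "Poly_Mapping.lookup p w \<noteq> 0 \<or> Poly_Mapping.lookup q w \<noteq> 0" by auto
  with p(2) q(2) show "letters w \<noteq> []" "set (letters w) \<subseteq> gens E" by blast+
qed

lemma free_sum:
  assumes "conj_subring R" "\<And>i. i \<in> I \<Longrightarrow> f i \<in> free R E"
  shows "(\<Sum>i\<in>I. f i) \<in> free R E"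
  using assms(2) by (induction I rule: infinite_finite_induct)
    (auto intro: free_add free_zero assms(1))

lemma free_single:
  assumes "conj_subring R" "c \<in> R" "letters w \<noteq> []" "set (letters w) \<subseteq> gens E"
  shows "Poly_Mapping.single w c \<in> free R E"
  using assms by (auto simp: free_def)

lemma free_mon:
  assumes "conj_subring R" "xs \<noteq> []" "set xs \<subseteq> gens E"
  shows "mon xs \<in> free R E"
  unfolding mon_def by (rule free_single[OF assms(1) conj_subringD(1)[OF assms(1)]]) (use assms in simp_all)

lemma sum_monomials:
  "(\<Sum>a\<in>Poly_Mapping.keys p. Poly_Mapping.single a (Poly_Mapping.lookup p a)) = p"
  by (rule poly_mapping_eqI)
    (auto simp: lookup_sum lookup_single when_def in_keys_iff sum.delta)

lemma mult_monomials:
  fixes p q :: "('v, 'e) free_alg"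
  shows "p * q = (\<Sum>a\<in>Poly_Mapping.keys p. \<Sum>b\<in>Poly_Mapping.keys q.
    Poly_Mapping.single (a + b) (Poly_Mapping.lookup p a * Poly_Mapping.lookup q b))"
proof -
  have "p * q = (\<Sum>a\<in>Poly_Mapping.keys p. Poly_Mapping.single a (Poly_Mapping.lookup p a)) *
      (\<Sum>b\<in>Poly_Mapping.keys q. Poly_Mapping.single b (Poly_Mapping.lookup q b))"
    by (simp only: sum_monomials)
  then show ?thesis by (simp only: sum_product mult_single)
qed

lemma free_mult:
  assumes "conj_subring R" "p \<in> free R E" "q \<in> free R E"
  shows "p * q \<in> free R E"
  unfolding mult_monomials[of p q]
proof (intro free_sum free_single assms(1))
  fix a b
  assume "a \<in> Poly_Mapping.keys p" "b \<in> Poly_Mapping.keys q"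
  with assms(2,3) have
    "letters a \<noteq> []" "set (letters a) \<subseteq> gens E" "Poly_Mapping.lookup p a \<in> R"
    "letters b \<noteq> []" "set (letters b) \<subseteq> gens E" "Poly_Mapping.lookup q b \<in> R"
    unfolding free_def by blast+
  then show "Poly_Mapping.lookup p a * Poly_Mapping.lookup q b \<in> R"
    "letters (a + b) \<noteq> []" "set (letters (a + b)) \<subseteq> gens E"
    using conj_subringD(5)[OF assms(1)] by (simp_all add: plus_word_def)
qed

lemma scale_eq: "scale c p = Poly_Mapping.map ((*) c) p"
  by (simp add: scale_def mult_map_scale_conv_mult)

lemma lookup_scale: "Poly_Mapping.lookup (scale c p) w = c * Poly_Mapping.lookup p w"
  unfolding scale_eq by (simp add: Poly_Mapping.map.rep_eq when_def)

lemma free_scale: "conj_subring R \<Longrightarrow> c \<in> R \<Longrightarrow> p \<in> free R E \<Longrightarrow> scale c p \<in> free R E"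
  by (simp add: free_iff lookup_scale conj_subringD(5))

lemma scale_minus_one: "scale (-1) p = - p"
  by (rule poly_mapping_eqI) (simp add: lookup_scale)

lemma free_uminus: "conj_subring R \<Longrightarrow> p \<in> free R E \<Longrightarrow> - p \<in> free R E"
  using free_scale[of R "-1" p E] by (simp add: scale_minus_one conj_subringD)

lemma free_diff: "conj_subring R \<Longrightarrow> p \<in> free R E \<Longrightarrow> q \<in> free R E \<Longrightarrow> p - q \<in> free R E"
  using free_add[of R p E "- q"] by (simp add: free_uminus)

lemma gen_star_gen_star [simp]: "gen_star (gen_star g) = g"
  by (cases g) auto

lemma word_star_word_star [simp]: "word_star (word_star w) = w"
  by (simp add: word_star_def rev_map comp_def)

lemma word_star_eq_iff: "word_star a = b \<longleftrightarrow> a = word_star b"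
  by auto

lemma word_star_plus: "word_star (a + b) = word_star b + word_star a"
  by (simp add: word_star_def plus_word_def)

lemma lookup_free_star:
  "Poly_Mapping.lookup (free_star p) w = cnj (Poly_Mapping.lookup p (word_star w))"
  by (auto simp: free_star_def lookup_sum lookup_single when_def word_star_eq_iff sum.delta'
      in_keys_iff)

lemma free_star_zero: "free_star 0 = 0"
  and free_star_add: "free_star (p + q) = free_star p + free_star q"
  and free_star_diff: "free_star (p - q) = free_star p - free_star q"
  and free_star_scale: "free_star (scale c p) = scale (cnj c) (free_star p)"
  and free_star_single: "free_star (Poly_Mapping.single w c) = Poly_Mapping.single (word_star w) (cnj c)"
  by (rule poly_mapping_eqI;
      auto simp: lookup_free_star lookup_add lookup_minus lookup_scale lookup_single when_def
        word_star_eq_iff)+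

lemma free_star_sum: "free_star (\<Sum>i\<in>I. f i) = (\<Sum>i\<in>I. free_star (f i))"
  by (induction I rule: infinite_finite_induct) (auto simp: free_star_zero free_star_add)

lemma free_star_mon: "free_star (mon xs) = mon (rev (map gen_star xs))"
  by (simp add: mon_def free_star_single word_star_def)

lemma free_star_mult: "free_star (p * q) = free_star q * free_star p"
proof -
  have "free_star (p * q) = (\<Sum>a\<in>Poly_Mapping.keys p. \<Sum>b\<in>Poly_Mapping.keys q.
      Poly_Mapping.single (word_star b) (cnj (Poly_Mapping.lookup q b)) *
      Poly_Mapping.single (word_star a) (cnj (Poly_Mapping.lookup p a)))"
    by (simp add: mult_monomials[of p q] free_star_sum free_star_single word_star_plus mult_single
        mult.commute)
  also have "\<dots> = (\<Sum>b\<in>Poly_Mapping.keys q. \<Sum>a\<in>Poly_Mapping.keys p.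
      Poly_Mapping.single (word_star b) (cnj (Poly_Mapping.lookup q b)) *
      Poly_Mapping.single (word_star a) (cnj (Poly_Mapping.lookup p a)))"
    by (rule sum.swap)
  also have "\<dots> = free_star q * free_star p"
    by (simp add: free_star_def sum_product)
  finally show ?thesis .
qed

lemma gen_star_gens: "g \<in> gens E \<Longrightarrow> gen_star g \<in> gens E"
  by (auto simp: gens_def)

lemma free_free_star:
  assumes "conj_subring R" "p \<in> free R E"
  shows "free_star p \<in> free R E"
  unfolding free_star_def
proof (intro free_sum free_single assms(1))
  fix w
  assume "w \<in> Poly_Mapping.keys p"
  with assms(2) have w:
    "letters w \<noteq> []" "set (letters w) \<subseteq> gens E" "Poly_Mapping.lookup p w \<in> R"
    unfolding free_def by blast+
  show "cnj (Poly_Mapping.lookup p w) \<in> R"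
    by (rule conj_subringD(6)[OF assms(1) w(3)])
  show "letters (word_star w) \<noteq> []" "set (letters (word_star w)) \<subseteq> gens E"
    using w(1,2) gen_star_gens by (auto simp: word_star_def)
qed

lemma relators_free:
  assumes "conj_subring R" "wf_digraph E" "x \<in> relators E"
  shows "x \<in> free R E"
proof -
  interpret wf_digraph E by fact
  note [intro!] = free_mon[OF assms(1)] free_diff[OF assms(1)] free_sum[OF assms(1)]
  show ?thesis
    using assms(3) by (induction) (auto simp: gens_def regular_def out_arcs_def)
qed

lemma rel_ideal_free:
  assumes "conj_subring R" "wf_digraph E" "x \<in> rel_ideal R E"
  shows "x \<in> free R E"
  using assms(3)
proof induction
  case zero
  show ?case by (rule free_zero[OF assms(1)])
next
  case (base x)
  show ?case by (rule relators_free[OF assms(1,2) base])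
next
  case (add x y)
  show ?case by (rule free_add[OF assms(1) add.IH])
next
  case (scale c x)
  show ?case by (rule free_scale[OF assms(1) scale.hyps(1) scale.IH])
next
  case (mult_left a x)
  show ?case by (rule free_mult[OF assms(1) mult_left.hyps(1) mult_left.IH])
next
  case (mult_right a x)
  show ?case by (rule free_mult[OF assms(1) mult_right.IH mult_right.hyps(1)])
qed

lemma relators_star:
  assumes "x \<in> relators E"
  shows "free_star x \<in> relators E"
  using assms
  by induction (auto simp: free_star_diff free_star_mon free_star_sum intro: relators.intros)

lemma rel_ideal_star:
  assumes "conj_subring R" "x \<in> rel_ideal R E"
  shows "free_star x \<in> rel_ideal R E"
  using assms(2)
proof induction
  case zero
  show ?case unfolding free_star_zero by (rule rel_ideal.zero)
next
  case (base x)
  show ?case by (rule rel_ideal.base[OF relators_star[OF base]])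
next
  case (add x y)
  show ?case unfolding free_star_add by (rule rel_ideal.add[OF add.IH])
next
  case (scale c x)
  show ?case unfolding free_star_scale
    by (rule rel_ideal.scale[OF conj_subringD(6)[OF assms(1) scale.hyps(1)] scale.IH])
next
  case (mult_left a x)
  show ?case unfolding free_star_mult
    by (rule rel_ideal.mult_right[OF free_free_star[OF assms(1) mult_left.hyps(1)] mult_left.IH])
next
  case (mult_right a x)
  show ?case unfolding free_star_mult
    by (rule rel_ideal.mult_left[OF free_free_star[OF assms(1) mult_right.hyps(1)] mult_right.IH])
qed

lemma rel_ideal_uminus: "conj_subring R \<Longrightarrow> x \<in> rel_ideal R E \<Longrightarrow> - x \<in> rel_ideal R E"
  using rel_ideal.scale[of "-1" R x E] by (simp add: scale_minus_one conj_subringD)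

lemma cls_eqI:
  assumes "conj_subring R" "x - y \<in> rel_ideal R E"
  shows "cls R E x = cls R E y"
proof -
  have "a - x \<in> rel_ideal R E" if "a - y \<in> rel_ideal R E" for a
    using rel_ideal.add[OF that rel_ideal_uminus[OF assms]] by simp
  moreover have "a - y \<in> rel_ideal R E" if "a - x \<in> rel_ideal R E" for a
    using rel_ideal.add[OF that assms(2)] by simp
  ultimately show ?thesis unfolding cls_def by blast
qed

lemma cls_self: "x \<in> free R E \<Longrightarrow> x \<in> cls R E x"
  by (simp add: cls_def rel_ideal.zero)

lemma UN_const: "x \<in> A \<Longrightarrow> (\<And>a. a \<in> A \<Longrightarrow> f a = C) \<Longrightarrow> (\<Union>a\<in>A. f a) = C"
  by blast

lemma cls_eq_iff:
  assumes "conj_subring R" "x \<in> free R E"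
  shows "cls R E x = cls R E y \<longleftrightarrow> x - y \<in> rel_ideal R E"
proof
  assume "cls R E x = cls R E y"
  then have "x \<in> cls R E y" using cls_self[OF assms(2)] by simp
  then show "x - y \<in> rel_ideal R E" by (simp add: cls_def)
qed (rule cls_eqI[OF assms(1)])

context
  fixes R :: "complex set" and E :: "('v, 'e) pre_digraph"
  assumes R: "conj_subring R"
begin

lemma leavitt_add:
  assumes "x \<in> free R E" "y \<in> free R E"
  shows "add (leavitt R E) (cls R E x) (cls R E y) = cls R E (x + y)"
proof -
  have "cls R E (a + b) = cls R E (x + y)" if "a \<in> cls R E x" "b \<in> cls R E y" for a b
  proof (rule cls_eqI[OF R])
    show "a + b - (x + y) \<in> rel_ideal R E"
      using rel_ideal.add[of "a - x" R E "b - y"] that by (simp add: cls_def algebra_simps)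
  qed
  then have "(\<Union>b\<in>cls R E y. cls R E (a + b)) = cls R E (x + y)" if "a \<in> cls R E x" for a
    using that by (intro UN_const[OF cls_self[OF assms(2)]])
  then show ?thesis
    unfolding leavitt_def star_algebra.simps by (intro UN_const[OF cls_self[OF assms(1)]])
qed

lemma leavitt_scale:
  assumes "c \<in> R" "x \<in> free R E"
  shows "scl (leavitt R E) c (cls R E x) = cls R E (scale c x)"
proof -
  have "cls R E (scale c a) = cls R E (scale c x)" if "a \<in> cls R E x" for a
  proof (rule cls_eqI[OF R])
    show "scale c a - scale c x \<in> rel_ideal R E"
      using rel_ideal.scale[OF assms(1), of "a - x" E] that
      by (simp add: cls_def scale_def algebra_simps)
  qed
  then show ?thesis
    unfolding leavitt_def star_algebra.simps by (intro UN_const[OF cls_self[OF assms(2)]])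
qed

lemma leavitt_mult:
  assumes "x \<in> free R E" "y \<in> free R E"
  shows "mul (leavitt R E) (cls R E x) (cls R E y) = cls R E (x * y)"
proof -
  have "cls R E (a * b) = cls R E (x * y)" if "a \<in> cls R E x" "b \<in> cls R E y" for a b
  proof (rule cls_eqI[OF R])
    have "(a - x) * b + x * (b - y) \<in> rel_ideal R E"
      using that assms unfolding cls_def
      by (intro rel_ideal.add rel_ideal.mult_left rel_ideal.mult_right) blast+
    then show "a * b - x * y \<in> rel_ideal R E"
      by (simp add: algebra_simps)
  qed
  then have "(\<Union>b\<in>cls R E y. cls R E (a * b)) = cls R E (x * y)" if "a \<in> cls R E x" for a
    using that by (intro UN_const[OF cls_self[OF assms(2)]])
  then show ?thesis
    unfolding leavitt_def star_algebra.simps by (intro UN_const[OF cls_self[OF assms(1)]])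
qed

lemma leavitt_star:
  assumes "x \<in> free R E"
  shows "str (leavitt R E) (cls R E x) = cls R E (free_star x)"
proof -
  have "cls R E (free_star a) = cls R E (free_star x)" if "a \<in> cls R E x" for a
  proof (rule cls_eqI[OF R])
    show "free_star a - free_star x \<in> rel_ideal R E"
      using rel_ideal_star[OF R, of "a - x" E] that by (simp add: cls_def free_star_diff)
  qed
  then show ?thesis
    unfolding leavitt_def star_algebra.simps by (intro UN_const[OF cls_self[OF assms]])
qed

lemma path_word_free: 
  assumes "pre_digraph.awalk E v p w"
  shows "mon (path_word v p) \<in> free R E"
  using assms
  by (intro free_mon[OF R]) (auto simp: path_word_def pre_digraph.awalk_def gens_def)

lemma leavitt_star_path_ghost:
  assumes "pre_digraph.awalk E v p w" "pre_digraph.awalk E v' q w"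
  shows "str (leavitt R E) (mul (leavitt R E) (path_elt R E v p)
           (str (leavitt R E) (path_elt R E v' q))) =
         mul (leavitt R E) (path_elt R E v' q) (str (leavitt R E) (path_elt R E v p))"
proof -
  have [simp]: "free_star (free_star x) = x" for x :: "('v, 'e) free_alg"
    by (rule poly_mapping_eqI) (simp add: lookup_free_star)
  show ?thesis
    using path_word_free[OF assms(1)] path_word_free[OF assms(2)]
    by (simp add: path_elt_def leavitt_star leavitt_mult free_free_star[OF R] free_mult[OF R]
        free_star_mult)
qed

end

end

theory Submission
  imports Defs
begin

text \<open>
  The diagonal is spanned by the elements \<open>\<mu>\<mu>\<^sup>*\<close>, which are projections, and a homomorphism of
  star algebras maps projections to projections. The theorem therefore follows once it is known that
  over a kind ring every projection \<open>a\<close> of a Leavitt path algebra is diagonal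
  (\<open>projection_in_spanned\<close>).

  Let the algebra act on the free module over a set \<open>X\<close> of paths, each infinite or ending at a vertex
  that is not regular, and each carrying an integer degree: an edge is prepended to a path and raises the degree by one, a ghost edge
  undoes this. Vertices, edges and ghost edges act as partial bijections, so every element gets a
  matrix with entries in \<open>R\<close> and finite columns, and the star becomes the conjugate transpose. For a
  projection, \<open>a = a\<^sup>*a\<close> says that the diagonal entry of a column is the sum of the squared absolute
  values of the entries of that column. Kindness of \<open>R\<close> is made for this situation: all entries
  off the diagonal vanish (\<open>projection_entry\<close>).

  It remains to read off from a diagonal matrix that the element is diagonal. Relation (LP5) can
  be used to write every element as a linear combination of products \<open>\<mu>\<nu>\<^sup>*\<close> in which
  \<open>\<nu>\<close> has a fixed length \<open>N\<close>, or is shorter and ends at a vertex that is not regular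
  (\<open>free_in_span_cut\<close>). If \<open>z\<close> is a path starting at the range of \<open>\<nu>\<close>, then \<open>\<mu>\<nu>\<^sup>*\<close>
  sends \<open>\<nu>z\<close> to \<open>\<mu>z\<close>, and the degree, which recovers the length of \<open>\<mu>\<close>, makes these images
  distinct for distinct \<open>\<mu>\<close>. For a suitable \<open>z\<close>, no other product in the combination has the same
  effect, unless it comes from a proper prefix of \<open>\<nu>\<close>; by induction on the length of \<open>\<nu>\<close>, the
  latter are all of the form \<open>\<nu>'\<nu>'\<^sup>*\<close> and fix \<open>\<nu>z\<close>. Hence the coefficient of
  \<open>\<mu>\<nu>\<^sup>*\<close> is a matrix entry, which is off the diagonal if \<open>\<mu> \<noteq> \<nu>\<close>
  (\<open>lincomb_diagonal\<close>).

  The degree cannot be dropped: if the graph is a single loop \<open>e\<close>, then there is only one infinite path,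
  and \<open>e\<close> itself would act as the identity.
\<close>

section \<open>Pairs of paths with a common range\<close>

context wf_digraph
begin

lemma walk_Cons:
  "awalk u (e # p) w \<longleftrightarrow> e \<in> arcs G \<and> u = tail G e \<and> awalk (head G e) p w"
  by (auto simp: awalk_Cons_iff)

lemma walk_Nil: "awalk u [] w \<longleftrightarrow> u = w \<and> w \<in> verts G"
  by (auto simp: awalk_Nil_iff)

text \<open>
  Stated for \<open>Ex (awalk u p)\<close> because the simplifier contracts \<open>\<exists>w. awalk u p w\<close> to this form,
  to which the two equations above no longer apply.
\<close>

lemma ex_walk:
  "Ex (awalk u []) \<longleftrightarrow> u \<in> verts G"
  "Ex (awalk u (e # p)) \<longleftrightarrow> e \<in> arcs G \<and> u = tail G e \<and> Ex (awalk (head G e) p)"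
  by (auto simp: walk_Nil walk_Cons)

lemma walk_end: "awalk u p w \<Longrightarrow> w \<in> verts G"
  by (induction p arbitrary: u) (auto simp: walk_Cons walk_Nil)

lemma walk_arcs: "awalk u p w \<Longrightarrow> set p \<subseteq> arcs G"
  by (simp add: awalk_def)

text \<open>
  The triple \<open>(p, w, q)\<close> stands for \<open>\<mu>\<nu>\<^sup>*\<close>, where \<open>\<mu>\<close> and \<open>\<nu>\<close> have the edges \<open>p\<close> and \<open>q\<close> and
  the common range \<open>w\<close>. Recording the range instead of the sources makes the encoding injective,
  including the paths of length 0.
\<close>

definition path_pairs :: "('b list \<times> 'a \<times> 'b list) set" where
  "path_pairs = {(p, w, q). (\<exists>u. awalk u p w) \<and> (\<exists>u. awalk u q w)}"

text \<open>
  The pairs at which repeated expansion by (LP5) stops when the second path may have length at most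
  \<open>N\<close>.
\<close>

definition cut_pairs :: "nat \<Rightarrow> ('b list \<times> 'a \<times> 'b list) set" where
  "cut_pairs N = {(p, w, q) \<in> path_pairs. length q = N \<or> length q < N \<and> \<not> regular G w}"

definition diagonal_pairs :: "('b list \<times> 'a \<times> 'b list) set" where
  "diagonal_pairs = {(p, w, q) \<in> path_pairs. p = q}"

end

section \<open>Spanning by products of paths and ghost paths\<close>

lemma mon_mult: "mon xs * mon ys = mon (xs @ ys)"
  by (simp add: mon_def mult_single plus_word_def)

lemma mon_Nil: "mon [] = 1"
  by (simp add: mon_def flip: zero_word_def)

lemma scale_diff: "scale c (p - q) = scale c p - scale c q"
  by (simp add: scale_def right_diff_distrib)

lemma scale_sum: "scale c (\<Sum>i\<in>I. f i) = (\<Sum>i\<in>I. scale c (f i))"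
  by (simp add: scale_def sum_distrib_left)

lemma scale_plus_left: "scale (c + d) p = scale c p + scale d p"
  by (rule poly_mapping_eqI) (simp add: lookup_scale lookup_add distrib_right)

lemma scale_scale: "scale c (scale d p) = scale (c * d) p"
  by (rule poly_mapping_eqI) (simp add: lookup_scale)

lemma scale_zero_left: "scale 0 p = 0"
  by (rule poly_mapping_eqI) (simp add: lookup_scale)

lemma scale_one: "scale 1 p = p"
  by (rule poly_mapping_eqI) (simp add: lookup_scale)

lemma single_eq_scale_mon: "Poly_Mapping.single w c = scale c (mon (letters w))"
  by (rule poly_mapping_eqI) (auto simp: lookup_scale mon_def lookup_single when_def)

text \<open>
  Writing the common range between the edges and the ghost edges gives a nonempty word for all
  pairs, with no special case for paths of length 0.
\<close>

definition path_ghost :: "'e list \<times> 'v \<times> 'e list \<Rightarrow> ('v, 'e) gen list" where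
  "path_ghost = (\<lambda>(p, w, q). map Edge p @ Vert w # rev (map Ghost q))"

definition lincomb :: "('e list \<times> 'v \<times> 'e list \<Rightarrow>\<^sub>0 complex) \<Rightarrow> ('v, 'e) free_alg" where
  "lincomb f = (\<Sum>t\<in>Poly_Mapping.keys f. scale (Poly_Mapping.lookup f t) (mon (path_ghost t)))"

lemma lincomb_superset:
  assumes "finite A" "Poly_Mapping.keys f \<subseteq> A"
  shows "lincomb f = (\<Sum>t\<in>A. scale (Poly_Mapping.lookup f t) (mon (path_ghost t)))"
  unfolding lincomb_def using assms
  by (intro sum.mono_neutral_left) (auto simp: in_keys_iff scale_zero_left)

lemma lincomb_add: "lincomb (f + g) = lincomb f + lincomb g"
proof -
  let ?A = "Poly_Mapping.keys f \<union> Poly_Mapping.keys g"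
  have "Poly_Mapping.keys (f + g) \<subseteq> ?A" by (rule keys_add)
  then show ?thesis
    by (simp add: lincomb_superset[of ?A] lookup_add scale_plus_left sum.distrib)
qed

lemma lincomb_map: "lincomb (Poly_Mapping.map ((*) c) f) = scale c (lincomb f)"
proof -
  have "Poly_Mapping.keys (Poly_Mapping.map ((*) c) f) \<subseteq> Poly_Mapping.keys f"
    by (auto simp: in_keys_iff Poly_Mapping.map.rep_eq when_def)
  then have "lincomb (Poly_Mapping.map ((*) c) f) = (\<Sum>t\<in>Poly_Mapping.keys f.
      scale (Poly_Mapping.lookup (Poly_Mapping.map ((*) c) f) t) (mon (path_ghost t)))"
    by (intro lincomb_superset) auto
  also have "\<dots> = scale c (lincomb f)"
    unfolding lincomb_def scale_sum scale_scale
    by (intro sum.cong refl) (auto simp: Poly_Mapping.map.rep_eq when_def in_keys_iff)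
  finally show ?thesis .
qed

text \<open>
  Computations in the Leavitt path algebra are carried out with representatives in the free algebra,
  modulo the ideal of relations.
\<close>

locale leavitt_path_algebra = wf_digraph E for E :: "('v, 'e) pre_digraph" +
  fixes R :: "complex set"
  assumes R: "conj_subring R"
begin

definition cong :: "('v, 'e) free_alg \<Rightarrow> ('v, 'e) free_alg \<Rightarrow> bool" (infix "\<approx>" 50) where
  "a \<approx> b \<longleftrightarrow> a - b \<in> rel_ideal R E"

lemma cong_refl: "a \<approx> a"
  by (simp add: cong_def rel_ideal.zero)

lemma cong_sym: "a \<approx> b \<Longrightarrow> b \<approx> a"
  using rel_ideal_uminus[OF R, of "a - b" E] by (simp add: cong_def)

lemma cong_trans [trans]: "a \<approx> b \<Longrightarrow> b \<approx> c \<Longrightarrow> a \<approx> c"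
  using rel_ideal.add[of "a - b" R E "b - c"] by (simp add: cong_def)

lemma cong_add: "a \<approx> b \<Longrightarrow> c \<approx> d \<Longrightarrow> a + c \<approx> b + d"
  using rel_ideal.add[of "a - b" R E "c - d"] by (simp add: cong_def algebra_simps)

lemma cong_scale: "c \<in> R \<Longrightarrow> a \<approx> b \<Longrightarrow> scale c a \<approx> scale c b"
  using rel_ideal.scale[of c R "a - b" E] by (simp add: cong_def scale_diff)

lemma cong_sum: "(\<And>i. i \<in> I \<Longrightarrow> f i \<approx> g i) \<Longrightarrow> (\<Sum>i\<in>I. f i) \<approx> (\<Sum>i\<in>I. g i)"
  by (induction I rule: infinite_finite_induct) (auto intro: cong_refl cong_add)

lemma cong_relator: "a - b \<in> relators E \<Longrightarrow> a \<approx> b"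
  by (simp add: cong_def rel_ideal.base)

text \<open>
  The empty word is not an element of the free algebra without unit, so that an empty context on
  either side has to be treated separately.
\<close>

lemma cong_context:
  assumes "a \<approx> b" "set us \<subseteq> gens E" "set vs \<subseteq> gens E"
  shows "mon us * a * mon vs \<approx> mon us * b * mon vs"
proof -
  have "mon us * (a - b) \<in> rel_ideal R E"
    using assms(1,2) free_mon[OF R, of us] unfolding cong_def
    by (cases "us = []") (auto simp: mon_Nil intro: rel_ideal.mult_left)
  then have "mon us * (a - b) * mon vs \<in> rel_ideal R E"
    using assms(3) free_mon[OF R, of vs]
    by (cases "vs = []") (auto simp: mon_Nil intro: rel_ideal.mult_right)
  then show ?thesis by (simp add: cong_def algebra_simps)
qed

lemma mon_cong:
  assumes "mon xs \<approx> mon ys" "set us \<subseteq> gens E" "set vs \<subseteq> gens E"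
  shows "mon (us @ xs @ vs) \<approx> mon (us @ ys @ vs)"
  using cong_context[OF assms] by (simp add: mon_mult)

lemma mon_cong_zero:
  assumes "mon xs \<approx> 0" "set us \<subseteq> gens E" "set vs \<subseteq> gens E"
  shows "mon (us @ xs @ vs) \<approx> 0"
  using cong_context[OF assms] by (simp add: mon_mult)

lemma gens_simps [simp]:
  "Vert v \<in> gens E \<longleftrightarrow> v \<in> verts E"
  "Edge e \<in> gens E \<longleftrightarrow> e \<in> arcs E"
  "Ghost e \<in> gens E \<longleftrightarrow> e \<in> arcs E"
  by (auto simp: gens_def)

lemma word_relations:
  shows "v \<in> verts E \<Longrightarrow> mon [Vert v, Vert v] \<approx> mon [Vert v]"
    and "v \<in> verts E \<Longrightarrow> w \<in> verts E \<Longrightarrow> v \<noteq> w \<Longrightarrow> mon [Vert v, Vert w] \<approx> 0"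
    and "e \<in> arcs E \<Longrightarrow> f \<in> arcs E \<Longrightarrow> e \<noteq> f \<Longrightarrow> mon [Ghost e, Edge f] \<approx> 0"
    and "e \<in> arcs E \<Longrightarrow> mon [Ghost e, Edge e] \<approx> mon [Vert (head E e)]"
    and "e \<in> arcs E \<Longrightarrow> mon [Vert (tail E e), Edge e] \<approx> mon [Edge e]"
    and "e \<in> arcs E \<Longrightarrow> mon [Edge e, Vert (head E e)] \<approx> mon [Edge e]"
    and "e \<in> arcs E \<Longrightarrow> mon [Ghost e, Vert (tail E e)] \<approx> mon [Ghost e]"
    and "e \<in> arcs E \<Longrightarrow> mon [Vert (head E e), Ghost e] \<approx> mon [Ghost e]"
    and "regular E v \<Longrightarrow> mon [Vert v] \<approx> (\<Sum>e\<in>out_arcs E v. mon [Edge e, Ghost e])"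
  by (rule cong_relator, simp add: relators.intros)+

lemma path_pairs_gens:
  assumes "t \<in> path_pairs"
  shows "set (path_ghost t) \<subseteq> gens E"
proof -
  obtain p w q u v where t: "t = (p, w, q)" "awalk u p w" "awalk v q w"
    using assms by (auto simp: path_pairs_def)
  show ?thesis
    using walk_arcs[OF t(2)] walk_arcs[OF t(3)] walk_end[OF t(2)]
    by (auto simp: t(1) path_ghost_def)
qed

lemma path_ghost_Cons: "path_ghost (e # p, w, q) = Edge e # path_ghost (p, w, q)"
  by (simp add: path_ghost_def)

text \<open>
  Vertices are orthogonal idempotents and \<open>\<mu> = s(\<mu>)\<mu>\<close>. All products of a single letter with
  \<open>\<mu>\<nu>\<^sup>*\<close> are reduced to this case by inserting the source or the range of the letter.
\<close>

lemma vertex_path_ghost: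
  assumes "(p, w, q) \<in> path_pairs" "awalk u p w" "v \<in> verts E"
  shows "mon (Vert v # path_ghost (p, w, q)) \<approx> (if v = u then mon (path_ghost (p, w, q)) else 0)"
proof (cases p)
  case Nil
  have "set (rev (map Ghost q)) \<subseteq> gens E"
    using path_pairs_gens[OF assms(1)] by (simp add: path_ghost_def)
  with Nil assms(2,3) show ?thesis
    using mon_cong[OF word_relations(1)[of v], of "[]" "rev (map Ghost q)"]
      mon_cong_zero[OF word_relations(2)[of v w], of "[]" "rev (map Ghost q)"]
    by (auto simp: path_ghost_def walk_Nil)
next
  case (Cons e p')
  have g: "set (path_ghost (p', w, q)) \<subseteq> gens E" and e: "e \<in> arcs E" "u = tail E e"
    using path_pairs_gens[OF assms(1)] Cons assms(2) by (auto simp: path_ghost_Cons walk_Cons)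
  show ?thesis
  proof (cases "v = u")
    case True
    then show ?thesis
      using mon_cong[OF word_relations(5)[OF e(1)], of "[]" "path_ghost (p', w, q)"] g e
      by (simp add: Cons path_ghost_Cons)
  next
    case False
    have "mon (Vert v # path_ghost (p, w, q)) \<approx> mon (Vert v # Vert u # path_ghost (p, w, q))"
      using mon_cong[OF cong_sym[OF word_relations(5)[OF e(1)]], of "[Vert v]" "path_ghost (p', w, q)"]
        g e assms(3) by (simp add: Cons path_ghost_Cons)
    also have "mon (Vert v # Vert u # path_ghost (p, w, q)) \<approx> 0"
      using mon_cong_zero[OF word_relations(2)[of v u], of "[]" "path_ghost (p, w, q)"]
        g e assms(3) False by (simp add: Cons path_ghost_Cons)
    finally show ?thesis using False by simp
  qed
qed

text \<open>
  Linear combinations are kept as finitely supported families of coefficients, since the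
  proof extracts individual coefficients.
\<close>

definition spanned :: "('e list \<times> 'v \<times> 'e list) set \<Rightarrow> ('v, 'e) free_alg set" where
  "spanned S = {a. \<exists>f. Poly_Mapping.keys f \<subseteq> S \<and> (\<forall>t. Poly_Mapping.lookup f t \<in> R) \<and> a \<approx> lincomb f}"

lemma spannedI:
  "Poly_Mapping.keys f \<subseteq> S \<Longrightarrow> (\<And>t. Poly_Mapping.lookup f t \<in> R) \<Longrightarrow> a \<approx> lincomb f \<Longrightarrow> a \<in> spanned S"
  unfolding spanned_def by (intro CollectI exI[of _ f] conjI allI)

lemma spanned_cong:
  assumes "a \<approx> b" "b \<in> spanned S"
  shows "a \<in> spanned S"
proof -
  obtain f where f: "Poly_Mapping.keys f \<subseteq> S" "\<forall>t. Poly_Mapping.lookup f t \<in> R" "b \<approx> lincomb f"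
    using assms(2) unfolding spanned_def by blast
  from cong_trans[OF assms(1) f(3)] show ?thesis using f(1,2) by (intro spannedI) blast+
qed

lemma spanned_zero: "0 \<in> spanned S"
  by (rule spannedI[of 0]) (simp_all add: lincomb_def cong_refl conj_subringD(2)[OF R])

lemma spanned_base: "t \<in> S \<Longrightarrow> mon (path_ghost t) \<in> spanned S"
  by (rule spannedI[of "Poly_Mapping.single t 1"])
    (auto simp: lincomb_def cong_refl lookup_single when_def scale_one conj_subringD(1,2)[OF R])

lemma spanned_add:
  assumes "a \<in> spanned S" "b \<in> spanned S"
  shows "a + b \<in> spanned S"
proof -
  obtain f g where f: "Poly_Mapping.keys f \<subseteq> S" "\<forall>t. Poly_Mapping.lookup f t \<in> R" "a \<approx> lincomb f"
    and g: "Poly_Mapping.keys g \<subseteq> S" "\<forall>t. Poly_Mapping.lookup g t \<in> R" "b \<approx> lincomb g"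
    using assms unfolding spanned_def by blast
  have "Poly_Mapping.keys (f + g) \<subseteq> S" using keys_add[of f g] f(1) g(1) by blast
  moreover have "\<forall>t. Poly_Mapping.lookup (f + g) t \<in> R"
    using f(2) g(2) by (simp add: lookup_add conj_subringD(4)[OF R])
  moreover have "a + b \<approx> lincomb (f + g)"
    unfolding lincomb_add by (rule cong_add[OF f(3) g(3)])
  ultimately show ?thesis by (intro spannedI) blast+
qed

lemma spanned_scale:
  assumes "c \<in> R" "a \<in> spanned S"
  shows "scale c a \<in> spanned S"
proof -
  obtain f where f: "Poly_Mapping.keys f \<subseteq> S" "\<forall>t. Poly_Mapping.lookup f t \<in> R" "a \<approx> lincomb f"
    using assms(2) unfolding spanned_def by blast
  let ?g = "Poly_Mapping.map ((*) c) f"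
  have "Poly_Mapping.keys ?g \<subseteq> S"
    using f(1) by (auto simp: in_keys_iff Poly_Mapping.map.rep_eq when_def split: if_splits)
  moreover have "\<forall>t. Poly_Mapping.lookup ?g t \<in> R"
    using f(2) by (simp add: Poly_Mapping.map.rep_eq when_def assms(1) conj_subringD(2,5)[OF R])
  moreover have "scale c a \<approx> lincomb ?g"
    unfolding lincomb_map by (rule cong_scale[OF assms(1) f(3)])
  ultimately show ?thesis by (intro spannedI) blast+
qed

lemma spanned_sum: "(\<And>i. i \<in> I \<Longrightarrow> f i \<in> spanned S) \<Longrightarrow> (\<Sum>i\<in>I. f i) \<in> spanned S"
  by (induction I rule: infinite_finite_induct) (auto intro: spanned_zero spanned_add)

lemma letter_in_span:
  assumes "g \<in> gens E"
  shows "mon [g] \<in> spanned path_pairs"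
proof (cases g)
  case (Vert v)
  have "mon (path_ghost ([], v, [])) \<in> spanned path_pairs"
    using assms Vert by (intro spanned_base) (auto simp: path_pairs_def walk_Nil)
  then show ?thesis by (simp add: Vert path_ghost_def)
next
  case (Edge e)
  have "mon (path_ghost ([e], head E e, [])) \<in> spanned path_pairs"
    using assms Edge by (intro spanned_base) (auto simp: path_pairs_def walk_Nil walk_Cons)
  then show ?thesis
    using spanned_cong[OF cong_sym[OF word_relations(6)[of e]]] assms by (simp add: Edge path_ghost_def)
next
  case (Ghost e)
  have "mon (path_ghost ([], head E e, [e])) \<in> spanned path_pairs"
    using assms Ghost by (intro spanned_base) (auto simp: path_pairs_def walk_Nil walk_Cons)
  then show ?thesis
    using spanned_cong[OF cong_sym[OF word_relations(8)[of e]]] assms by (simp add: Ghost path_ghost_def)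
qed

text \<open>
  Up to the relations, multiplying \<open>\<mu>\<nu>\<^sup>*\<close> from the left by a letter either gives \<open>0\<close> or a single
  product of this kind: an edge lengthens \<open>\<mu>\<close>; a ghost edge cancels the first edge of
  \<open>\<mu>\<close>, or lengthens \<open>\<nu>\<close> if \<open>\<mu>\<close> is a vertex.
\<close>

lemma letter_path_ghost_in_span:
  assumes "g \<in> gens E" "t \<in> path_pairs"
  shows "mon (g # path_ghost t) \<in> spanned path_pairs"
proof -
  obtain p w q where t: "t = (p, w, q)" by (cases t) auto
  obtain u u' where u: "awalk u p w" "awalk u' q w" using assms(2) by (auto simp: t path_pairs_def)
  note g = path_pairs_gens[OF assms(2)] 
  note base = spanned_base[OF assms(2)]
  note vertex = vertex_path_ghost[OF assms(2)[unfolded t]]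
  show ?thesis
  proof (cases g)
    case (Vert v)
    then show ?thesis
      using spanned_cong[OF vertex[OF u(1), of v]] assms(1) base spanned_zero by (auto simp: t split: if_splits)
  next
    case (Edge e)
    then have e: "e \<in> arcs E" using assms(1) by simp
    show ?thesis
    proof (cases "u = head E e")
      case True
      then have "(e # p, w, q) \<in> path_pairs" using e u by (auto simp: path_pairs_def walk_Cons)
      from spanned_base[OF this] show ?thesis by (simp add: t Edge path_ghost_Cons)
    next
      case False
      have "mon (Edge e # path_ghost t) \<approx> mon ([Edge e] @ Vert (head E e) # path_ghost t)"
        using mon_cong[OF cong_sym[OF word_relations(6)[OF e]], of "[]" "path_ghost t"] g by simp
      also have "\<dots> \<approx> 0"
        using mon_cong_zero[of "Vert (head E e) # path_ghost t" "[Edge e]" "[]"]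
          vertex[OF u(1), of "head E e"] False e by (simp add: t)
      finally show ?thesis unfolding Edge by (rule spanned_cong[OF _ spanned_zero])
    qed
  next
    case (Ghost e)
    then have e: "e \<in> arcs E" using assms(1) by simp
    show ?thesis
    proof (cases p)
      case Nil
      have q: "set (rev (map Ghost q)) \<subseteq> gens E" using g by (simp add: t path_ghost_def)
      have w: "w \<in> verts E" "u = w" using u(1) Nil by (simp_all add: walk_Nil)
      show ?thesis
      proof (cases "tail E e = w")
        case True
        have "mon (Ghost e # path_ghost t) \<approx> mon (Ghost e # rev (map Ghost q))"
          using mon_cong[OF word_relations(7)[OF e], of "[]" "rev (map Ghost q)"] q True
          by (simp add: t Nil path_ghost_def)
        also have "\<dots> \<approx> mon (path_ghost ([], head E e, q @ [e]))"
          using mon_cong[OF cong_sym[OF word_relations(8)[OF e]], of "[]" "rev (map Ghost q)"] q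
          by (simp add: path_ghost_def)
        finally have c: "mon (Ghost e # path_ghost t) \<approx> mon (path_ghost ([], head E e, q @ [e]))" .
        have "awalk u' (q @ [e]) (head E e)"
          using u(2) True e by (auto simp: walk_Nil walk_Cons)
        then have "([], head E e, q @ [e]) \<in> path_pairs"
          using e by (auto simp: path_pairs_def walk_Nil)
        from spanned_cong[OF c spanned_base[OF this]] show ?thesis by (simp add: Ghost)
      next
        case False
        have "mon (Ghost e # path_ghost t) \<approx> mon ([Ghost e] @ Vert (tail E e) # path_ghost t)"
          using mon_cong[OF cong_sym[OF word_relations(7)[OF e]], of "[]" "path_ghost t"] g by simp
        also have "\<dots> \<approx> 0"
          using mon_cong_zero[of "Vert (tail E e) # path_ghost t" "[Ghost e]" "[]"]
            vertex[OF u(1), of "tail E e"] False e w by (simp add: t)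
        finally show ?thesis unfolding Ghost by (rule spanned_cong[OF _ spanned_zero])
      qed
    next
      case (Cons f p')
      have f: "f \<in> arcs E" "awalk (head E f) p' w" using u(1) Cons by (simp_all add: walk_Cons)
      have g': "set (path_ghost (p', w, q)) \<subseteq> gens E" using g by (simp add: t Cons path_ghost_Cons)
      have t': "(p', w, q) \<in> path_pairs" using f u(2) by (auto simp: path_pairs_def)
      show ?thesis
      proof (cases "e = f")
        case True
        have "mon (Ghost e # path_ghost t) \<approx> mon (Vert (head E e) # path_ghost (p', w, q))"
          using mon_cong[OF word_relations(4)[OF e], of "[]" "path_ghost (p', w, q)"] g'
          by (simp add: t Cons path_ghost_Cons True)
        also have "\<dots> \<approx> mon (path_ghost (p', w, q))"
          using vertex_path_ghost[OF t' f(2), of "head E e"] e True by simp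
        finally show ?thesis unfolding Ghost by (rule spanned_cong[OF _ spanned_base[OF t']])
      next
        case False
        have "mon (Ghost e # path_ghost t) \<approx> 0"
          using mon_cong_zero[OF word_relations(3)[OF e f(1) False], of "[]" "path_ghost (p', w, q)"] g'
          by (simp add: t Cons path_ghost_Cons)
        then show ?thesis unfolding Ghost by (rule spanned_cong[OF _ spanned_zero])
      qed
    qed
  qed
qed

lemma letter_mult_span:
  assumes "g \<in> gens E" "a \<in> spanned path_pairs"
  shows "mon [g] * a \<in> spanned path_pairs"
proof -
  obtain f where f: "Poly_Mapping.keys f \<subseteq> path_pairs" "\<forall>t. Poly_Mapping.lookup f t \<in> R"
    "a \<approx> lincomb f" using assms(2) unfolding spanned_def by blast
  have "mon [g] * a \<approx> mon [g] * lincomb f"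
    using cong_context[OF f(3), of "[g]" "[]"] assms(1) by (simp add: mon_Nil)
  moreover have "mon [g] * scale c b = scale c (mon [g] * b)" for c b
    unfolding scale_eq
    by (rule poly_mapping_eqI)
      (simp add: scale_eq[symmetric] scale_def mon_def mult.assoc[symmetric] mult_single)
  then have "mon [g] * lincomb f \<in> spanned path_pairs"
    using f assms(1)
    by (auto simp: lincomb_def sum_distrib_left mon_mult
        intro!: spanned_sum spanned_scale letter_path_ghost_in_span)
  ultimately show ?thesis by (rule spanned_cong)
qed

lemma word_in_span:
  "xs \<noteq> [] \<Longrightarrow> set xs \<subseteq> gens E \<Longrightarrow> mon xs \<in> spanned path_pairs"
proof (induction xs)
  case (Cons g xs)
  show ?case
  proof (cases "xs = []")
    case True
    then show ?thesis using letter_in_span Cons.prems by simp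
  next
    case False
    then show ?thesis
      using letter_mult_span[of g "mon xs"] Cons by (simp add: mon_mult)
  qed
qed simp

lemma free_subset_span: "free R E \<subseteq> spanned path_pairs"
proof
  fix a assume "a \<in> free R E"
  then have "(\<Sum>w\<in>Poly_Mapping.keys a. Poly_Mapping.single w (Poly_Mapping.lookup a w)) \<in> spanned path_pairs"
    unfolding single_eq_scale_mon free_def by (intro spanned_sum spanned_scale word_in_span) auto
  then show "a \<in> spanned path_pairs" by (simp only: sum_monomials)
qed

lemma expand_regular:
  assumes "(p, w, q) \<in> path_pairs" "regular E w"
  shows "mon (path_ghost (p, w, q)) \<approx>
    (\<Sum>e\<in>out_arcs E w. mon (path_ghost (p @ [e], head E e, q @ [e])))"
proof -
  have g: "set (map Edge p) \<subseteq> gens E" "set (rev (map Ghost q)) \<subseteq> gens E"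
    using path_pairs_gens[OF assms(1)] by (simp_all add: path_ghost_def)
  have "mon (path_ghost (p, w, q)) \<approx>
      mon (map Edge p) * (\<Sum>e\<in>out_arcs E w. mon [Edge e, Ghost e]) * mon (rev (map Ghost q))"
    using cong_context[OF word_relations(9)[OF assms(2)] g] by (simp add: mon_mult path_ghost_def)
  also have "\<dots> = (\<Sum>e\<in>out_arcs E w. mon (map Edge p @ [Edge e] @ Ghost e # rev (map Ghost q)))"
    by (simp add: sum_distrib_left sum_distrib_right mon_mult)
  also have "\<dots> \<approx> (\<Sum>e\<in>out_arcs E w. mon (path_ghost (p @ [e], head E e, q @ [e])))"
  proof (rule cong_sum)
    fix e assume "e \<in> out_arcs E w"
    then have e: "e \<in> arcs E" by simp
    show "mon (map Edge p @ [Edge e] @ Ghost e # rev (map Ghost q)) \<approx>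
        mon (path_ghost (p @ [e], head E e, q @ [e]))"
      using mon_cong[OF cong_sym[OF word_relations(6)[OF e]], of "map Edge p" "Ghost e # rev (map Ghost q)"]
        g e by (simp add: path_ghost_def)
  qed
  finally show ?thesis .
qed

text \<open>
  Each expansion lengthens the second path by one, and (LP5) is available exactly at regular ranges.
\<close>

lemma path_ghost_in_span_cut:
  "(p, w, q) \<in> path_pairs \<Longrightarrow> length q \<le> N \<Longrightarrow> mon (path_ghost (p, w, q)) \<in> spanned (cut_pairs N)"
proof (induction "N - length q" arbitrary: p w q)
  case 0
  then show ?case by (intro spanned_base) (auto simp: cut_pairs_def)
next
  case (Suc n)
  show ?case
  proof (cases "regular E w")
    case True
    have "mon (path_ghost (p @ [e], head E e, q @ [e])) \<in> spanned (cut_pairs N)"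
      if "e \<in> out_arcs E w" for e
    proof (rule Suc.hyps(1))
      obtain u u' where "awalk u p w" "awalk u' q w"
        using Suc.prems by (auto simp: path_pairs_def)
      with that have "awalk u (p @ [e]) (head E e)" "awalk u' (q @ [e]) (head E e)"
        by (auto simp: walk_Cons walk_Nil)
      then show "(p @ [e], head E e, q @ [e]) \<in> path_pairs" by (auto simp: path_pairs_def)
    qed (use Suc.hyps(2) in auto)
    then show ?thesis by (intro spanned_cong[OF expand_regular[OF Suc.prems(1) True]] spanned_sum)
  next
    case False
    with Suc show ?thesis by (intro spanned_base) (auto simp: cut_pairs_def)
  qed
qed

lemma free_in_span_cut:
  assumes "a \<in> free R E"
  obtains N where "a \<in> spanned (cut_pairs N)"
proof -
  obtain f where f: "Poly_Mapping.keys f \<subseteq> path_pairs" "\<forall>t. Poly_Mapping.lookup f t \<in> R"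
    "a \<approx> lincomb f" using assms free_subset_span unfolding spanned_def by blast
  obtain N where N: "\<And>t. t \<in> Poly_Mapping.keys f \<Longrightarrow> length (snd (snd t)) \<le> N"
    using finite_nat_set_iff_bounded_le[of "(\<lambda>t. length (snd (snd t))) ` Poly_Mapping.keys f"] by auto
  have "mon (path_ghost t) \<in> spanned (cut_pairs N)" if "t \<in> Poly_Mapping.keys f" for t
    using path_ghost_in_span_cut[of "fst t" "fst (snd t)" "snd (snd t)"] f(1) N[OF that] that by auto
  then have "lincomb f \<in> spanned (cut_pairs N)"
    unfolding lincomb_def using f(2) by (intro spanned_sum spanned_scale) auto
  with f(3) have "a \<in> spanned (cut_pairs N)" by (rule spanned_cong)
  then show ?thesis by (rule that)
qed

end

section \<open>Kind rings\<close>

text \<open>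
  The condition that defines kind rings, with the summands indexed by a finite set and the
  distinguished summand at an arbitrary index.
\<close>

lemma kind_sum:
  assumes "kind R" "finite Y" "x \<in> Y" "\<And>y. y \<in> Y \<Longrightarrow> c y \<in> R"
    and sum: "c x = of_real (\<Sum>y\<in>Y. (cmod (c y))\<^sup>2)"
    and y: "y \<in> Y" "y \<noteq> x"
  shows "c y = 0"
proof -
  obtain h and n :: nat where h: "bij_betw h {1..n} (Y - {x})"
    using ex_bij_betw_nat_finite_1[of "Y - {x}"] assms(2) by blast
  define l where "l i = (if i = 0 then c x else c (h i))" for i :: nat
  have hY: "h i \<in> Y" if "i \<in> {1..n}" for i
    using bij_betwE[OF h] that by blast
  have "(\<Sum>y\<in>Y. (cmod (c y))\<^sup>2) = (cmod (c x))\<^sup>2 + (\<Sum>y\<in>Y - {x}. (cmod (c y))\<^sup>2)"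
    using assms(2,3) by (simp add: sum.remove)
  also have "(\<Sum>y\<in>Y - {x}. (cmod (c y))\<^sup>2) = (\<Sum>i\<in>{1..n}. (cmod (l i))\<^sup>2)"
    unfolding sum.reindex_bij_betw[OF h, symmetric] by (intro sum.cong) (auto simp: l_def)
  also have "(cmod (c x))\<^sup>2 + \<dots> = (\<Sum>i\<le>n. (cmod (l i))\<^sup>2)"
    by (simp add: atMost_atLeast0 sum.atLeast_Suc_atMost l_def)
  finally have "l 0 = of_real (\<Sum>i\<le>n. (cmod (l i))\<^sup>2)"
    using sum by (simp add: l_def)
  moreover have "l i \<in> R" if "i \<le> n" for i
    using that assms(3,4) hY by (cases "i = 0") (auto simp: l_def)
  ultimately have "\<forall>i\<in>{1..n}. l i = 0"
    using assms(1) unfolding kind_def by blast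
  moreover obtain i where "i \<in> {1..n}" "y = h i"
    using bij_betw_imp_surj_on[OF h] y by blast
  ultimately show ?thesis by (force simp: l_def)
qed

section \<open>Graded branching systems\<close>

text \<open>
  The data needed to represent the Leavitt path algebra on the free module over \<open>X\<close>: an
  element with source \<open>v\<close> is to be thought of as a path starting at \<open>v\<close>, and \<open>shift e\<close> as
  prepending the edge \<open>e\<close>. That every element over a regular vertex arises by prepending an edge
  gives (LP5). Over every other vertex, the last assumption asks for an element that arises
  from no edge, such as the path of length 0 at that vertex; these elements separate \<open>\<nu>\<nu>\<^sup>*\<close> from
  the projections of the extensions of \<open>\<nu>\<close>.
\<close>

locale graded_branching_system = wf_digraph E for E :: "('v, 'e) pre_digraph" +
  fixes X :: "'x set" and src :: "'x \<Rightarrow> 'v" and shift :: "'e \<Rightarrow> 'x \<Rightarrow> 'x" and deg :: "'x \<Rightarrow> int"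
  assumes shift_in: "\<lbrakk>e \<in> arcs E; x \<in> X; src x = head E e\<rbrakk> \<Longrightarrow>
      shift e x \<in> X \<and> src (shift e x) = tail E e \<and> deg (shift e x) = deg x + 1"
    and shift_inj: "\<lbrakk>e \<in> arcs E; x \<in> X; src x = head E e; f \<in> arcs E; y \<in> X; src y = head E f;
      shift e x = shift f y\<rbrakk> \<Longrightarrow> e = f \<and> x = y"
    and shift_surj: "\<lbrakk>x \<in> X; regular E (src x)\<rbrakk> \<Longrightarrow>
      \<exists>e\<in>arcs E. \<exists>y\<in>X. src y = head E e \<and> x = shift e y"
    and fibre: "v \<in> verts E \<Longrightarrow> \<exists>x\<in>X. src x = v \<and>
      (regular E v \<or> (\<forall>e\<in>arcs E. \<forall>y\<in>X. src y = head E e \<longrightarrow> x \<noteq> shift e y))"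
begin

text \<open>
  The partial bijections are given as relations, with the ghost edge as the converse of the edge.
  This builds the compatibility with the star into the definition. Words act from right to left, as
  operators do.
\<close>

fun step :: "('v, 'e) gen \<Rightarrow> 'x \<Rightarrow> 'x \<Rightarrow> bool" where
  "step (Vert v) x y \<longleftrightarrow> x \<in> X \<and> src x = v \<and> y = x"
| "step (Edge e) x y \<longleftrightarrow> e \<in> arcs E \<and> x \<in> X \<and> src x = head E e \<and> y = shift e x"
| "step (Ghost e) x y \<longleftrightarrow> e \<in> arcs E \<and> y \<in> X \<and> src y = head E e \<and> x = shift e y"

fun run :: "('v, 'e) gen list \<Rightarrow> 'x \<Rightarrow> 'x \<Rightarrow> bool" where
  "run [] x y \<longleftrightarrow> x = y"
| "run (g # gs) x y \<longleftrightarrow> (\<exists>z. run gs x z \<and> step g z y)"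

lemma step_star: "step (gen_star g) x y \<longleftrightarrow> step g y x"
  by (cases g) auto

lemma step_unique: "step g x y \<Longrightarrow> step g x z \<Longrightarrow> y = z"
proof (cases g)
  case (Ghost e)
  then show "step g x y \<Longrightarrow> step g x z \<Longrightarrow> y = z" using shift_inj[of e y e z] by auto
qed auto

lemma run_append: "run (gs @ hs) x y \<longleftrightarrow> (\<exists>z. run hs x z \<and> run gs z y)"
  by (induction gs arbitrary: y) auto

lemma run_star: "run (rev (map gen_star gs)) x y \<longleftrightarrow> run gs y x"
  by (induction gs arbitrary: x) (auto simp: run_append step_star)

lemma run_unique: "run gs x y \<Longrightarrow> run gs x z \<Longrightarrow> y = z"
proof (induction gs arbitrary: y z)
  case (Cons g gs)
  then show ?case using step_unique by (metis run.simps(2))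
qed simp

text \<open>The matrix entry in row \<open>y\<close> and column \<open>x\<close>.\<close>

definition entry :: "('v, 'e) free_alg \<Rightarrow> 'x \<Rightarrow> 'x \<Rightarrow> complex" where
  "entry a y x = (\<Sum>w\<in>Poly_Mapping.keys a. Poly_Mapping.lookup a w * of_bool (run (letters w) x y))"

lemma entry_superset:
  assumes "finite A" "Poly_Mapping.keys a \<subseteq> A"
  shows "entry a y x = (\<Sum>w\<in>A. Poly_Mapping.lookup a w * of_bool (run (letters w) x y))"
  unfolding entry_def using assms by (intro sum.mono_neutral_left) (auto simp: in_keys_iff)

lemma entry_add: "entry (a + b) y x = entry a y x + entry b y x"
proof -
  let ?A = "Poly_Mapping.keys a \<union> Poly_Mapping.keys b"
  have "Poly_Mapping.keys (a + b) \<subseteq> ?A" by (rule keys_add)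
  then show ?thesis
    by (simp add: entry_superset[of ?A] lookup_add sum.distrib distrib_right)
qed

lemma entry_zero: "entry 0 y x = 0"
  by (simp add: entry_def)

lemma entry_sum: "entry (\<Sum>i\<in>I. f i) y x = (\<Sum>i\<in>I. entry (f i) y x)"
  by (induction I rule: infinite_finite_induct) (auto simp: entry_zero entry_add)

lemma entry_single: "entry (Poly_Mapping.single w c) y x = c * of_bool (run (letters w) x y)"
  by (simp add: entry_superset[of "{w}"])

lemma entry_mon: "entry (mon xs) y x = of_bool (run xs x y)"
  by (simp add: mon_def entry_single)

lemma entry_scale: "entry (scale c a) y x = c * entry a y x"
proof -
  have "Poly_Mapping.keys (scale c a) \<subseteq> Poly_Mapping.keys a"
    by (auto simp: in_keys_iff lookup_scale)
  then show ?thesis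
    by (simp add: entry_superset[of "Poly_Mapping.keys a"] lookup_scale sum_distrib_left mult.assoc
        del: sum_mult_of_bool_eq sum_of_bool_mult_eq)
qed

lemma entry_diff: "entry (a - b) y x = entry a y x - entry b y x"
  using entry_add[of "a - b" b] by (simp add: algebra_simps)

lemma entry_star: "entry (free_star a) y x = cnj (entry a x y)"
  unfolding free_star_def entry_sum entry_single unfolding entry_def
  by (simp add: word_star_def run_star)

lemma entry_in:
  assumes "conj_subring R" "a \<in> free R E"
  shows "entry a y x \<in> R"
proof -
  have sum: "(\<Sum>i\<in>I. f i) \<in> R" if "\<And>i. i \<in> I \<Longrightarrow> f i \<in> R" for I and f :: "('v, 'e) word \<Rightarrow> complex"
    using that by (induction I rule: infinite_finite_induct)
      (auto intro: conj_subringD(2,4)[OF assms(1)])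
  show ?thesis
    unfolding entry_def using assms conj_subringD(2)[OF assms(1)]
    by (intro sum) (auto simp: free_def of_bool_def)
qed

text \<open>
  A finite set that contains the support of column \<open>x\<close>. It is defined from the words of \<open>a\<close> and not
  from the entries, whose summands may cancel: the product formula \<open>entry_mult\<close> needs every
  intermediate point of every pair of words.
\<close>

definition reach :: "('v, 'e) free_alg \<Rightarrow> 'x \<Rightarrow> 'x set" where
  "reach a x = {y. \<exists>w\<in>Poly_Mapping.keys a. run (letters w) x y}"

lemma finite_reach: "finite (reach a x)"
proof -
  have "finite {y. run (letters w) x y}" for w
  proof (cases "\<exists>y. run (letters w) x y")
    case True
    then obtain y where "run (letters w) x y" by blast
    then have "{y. run (letters w) x y} \<subseteq> {y}" using run_unique by blast
    then show ?thesis by (rule finite_subset) simp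
  qed simp
  moreover have "reach a x = (\<Union>w\<in>Poly_Mapping.keys a. {y. run (letters w) x y})"
    by (auto simp: reach_def)
  ultimately show ?thesis by simp
qed

lemma entry_outside_reach: "y \<notin> reach a x \<Longrightarrow> entry a y x = 0"
  unfolding entry_def reach_def by (intro sum.neutral) auto

lemma entry_mult:
  assumes "finite Y" "reach b x \<subseteq> Y"
  shows "entry (a * b) z x = (\<Sum>y\<in>Y. entry a z y * entry b y x)"
proof -
  have comp: "of_bool (run (letters (u + w)) x z) =
      (\<Sum>y\<in>Y. of_bool (run (letters u) y z) * of_bool (run (letters w) x y) :: complex)"
    if w: "w \<in> Poly_Mapping.keys b" for u w
  proof (cases "\<exists>y. run (letters w) x y")
    case True
    then obtain y where y: "run (letters w) x y" by blast
    then have "y \<in> Y" using assms(2) w by (auto simp: reach_def)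
    have uniq: "run (letters w) x y' \<longleftrightarrow> y' = y" for y' using y run_unique by blast
    have "(\<Sum>y'\<in>Y. of_bool (run (letters u) y' z) * of_bool (run (letters w) x y') :: complex) =
        (\<Sum>y'\<in>Y. if y' = y then of_bool (run (letters u) y z) else 0)"
      by (intro sum.cong) (auto simp: uniq)
    also have "\<dots> = of_bool (run (letters u) y z)"
      using assms(1) \<open>y \<in> Y\<close> by (simp add: sum.delta)
    finally show ?thesis by (simp add: plus_word_def run_append uniq)
  qed (simp add: plus_word_def run_append)
  have "entry (a * b) z x = (\<Sum>u\<in>Poly_Mapping.keys a. \<Sum>w\<in>Poly_Mapping.keys b.
      Poly_Mapping.lookup a u * Poly_Mapping.lookup b w * of_bool (run (letters (u + w)) x z))"
    by (simp only: mult_monomials[of a b] entry_sum entry_single)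
  also have "\<dots> = (\<Sum>u\<in>Poly_Mapping.keys a. \<Sum>w\<in>Poly_Mapping.keys b. \<Sum>y\<in>Y.
      (Poly_Mapping.lookup a u * of_bool (run (letters u) y z)) *
      (Poly_Mapping.lookup b w * of_bool (run (letters w) x y)))"
    by (intro sum.cong refl) (simp add: comp sum_distrib_left mult_ac)
  also have "\<dots> = (\<Sum>u\<in>Poly_Mapping.keys a. \<Sum>y\<in>Y. \<Sum>w\<in>Poly_Mapping.keys b.
      (Poly_Mapping.lookup a u * of_bool (run (letters u) y z)) *
      (Poly_Mapping.lookup b w * of_bool (run (letters w) x y)))"
    by (intro sum.cong refl sum.swap)
  also have "\<dots> = (\<Sum>y\<in>Y. \<Sum>u\<in>Poly_Mapping.keys a. \<Sum>w\<in>Poly_Mapping.keys b.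
      (Poly_Mapping.lookup a u * of_bool (run (letters u) y z)) *
      (Poly_Mapping.lookup b w * of_bool (run (letters w) x y)))"
    by (rule sum.swap)
  also have "\<dots> = (\<Sum>y\<in>Y. entry a z y * entry b y x)"
    unfolding entry_def sum_product ..
  finally show ?thesis .
qed

text \<open>
  The relation (LP5) is the only one that is not a comparison of two partial bijections: it holds
  because every \<open>x\<close> over a regular vertex is \<open>shift e z\<close> for exactly one edge \<open>e\<close>, so that exactly one
  summand contributes.
\<close>

lemma entry_relator:
  assumes "a \<in> relators E"
  shows "entry a y x = 0"
  using assms
proof cases
  case (LP5 v)
  have "run [Vert v] x y \<longleftrightarrow> (\<exists>e\<in>out_arcs E v. run [Edge e, Ghost e] x y)"
  proof
    assume "run [Vert v] x y"
    then have "x \<in> X" "src x = v" "y = x" by auto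
    moreover obtain e z where "e \<in> arcs E" "z \<in> X" "src z = head E e" "x = shift e z"
      using shift_surj[of x] LP5 \<open>x \<in> X\<close> \<open>src x = v\<close> by blast
    ultimately show "\<exists>e\<in>out_arcs E v. run [Edge e, Ghost e] x y"
      using shift_in[of e z] by auto
  qed (auto simp: shift_in)
  note decomposition = this
  have unique: "e = f" if e: "run [Edge e, Ghost e] x y" and f: "run [Edge f, Ghost f] x y" for e f
  proof -
    obtain z where z: "e \<in> arcs E" "z \<in> X" "src z = head E e" "x = shift e z"
      using e by auto
    moreover obtain z' where "f \<in> arcs E" "z' \<in> X" "src z' = head E f" "x = shift f z'"
      using f by auto
    ultimately show ?thesis using shift_inj[of e z f z'] by simp
  qed
  have fin: "finite (out_arcs E v)" using LP5 by (simp add: regular_def)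
  have count: "of_bool (run [Vert v] x y) =
      (\<Sum>e\<in>out_arcs E v. of_bool (run [Edge e, Ghost e] x y) :: complex)"
  proof (cases "run [Vert v] x y")
    case True
    then obtain e where e: "e \<in> out_arcs E v" "run [Edge e, Ghost e] x y"
      using decomposition by blast
    have "(\<Sum>f\<in>out_arcs E v. of_bool (run [Edge f, Ghost f] x y) :: complex) =
        (\<Sum>f\<in>out_arcs E v. if f = e then 1 else 0)"
    proof (intro sum.cong refl)
      fix f
      show "of_bool (run [Edge f, Ghost f] x y) = (if f = e then 1 else (0 :: complex))"
      proof (cases "f = e")
        case False
        then have "\<not> run [Edge f, Ghost f] x y" using unique[OF _ e(2)] by blast
        with False show ?thesis by (simp only: of_bool_eq if_False)
      qed (use e(2) in \<open>simp only: of_bool_eq if_True refl\<close>)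
    qed
    also have "\<dots> = 1" using e(1) fin by (simp only: sum.delta if_True)
    finally show ?thesis using True by (simp only: of_bool_eq)
  next
    case False
    then have "\<not> run [Edge e, Ghost e] x y" if "e \<in> out_arcs E v" for e
      using that decomposition by blast
    then have "(\<Sum>e\<in>out_arcs E v. of_bool (run [Edge e, Ghost e] x y) :: complex) = 0"
      by (intro sum.neutral ballI) (simp only: of_bool_eq if_False of_bool_eq_0_iff not_False_eq_True)
    then show ?thesis using False by (simp only: of_bool_eq)
  qed
  show ?thesis
    by (simp only: LP5(1) entry_diff entry_sum entry_mon count diff_self)
next
  case (LP1 e f)
  have "\<not> run [Ghost e, Edge f] x y"
    using shift_inj[of f x e y] LP1 by auto
  then show ?thesis by (simp add: LP1 entry_mon del: run.simps)
next
  case (LP2 e)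
  have "run [Ghost e, Edge e] x y \<longleftrightarrow> run [Vert (head E e)] x y"
    using shift_inj[of e x e y] LP2 by auto
  then show ?thesis by (simp add: LP2 entry_diff entry_mon del: run.simps)
qed (auto simp: entry_diff entry_mon shift_in)

lemma entry_rel_ideal:
  assumes "a \<in> rel_ideal R E"
  shows "entry a y x = 0"
  using assms
proof (induction arbitrary: x y)
  case (mult_left a b)
  then show ?case by (simp add: entry_mult[OF finite_reach order_refl])
next
  case (mult_right a b)
  then show ?case by (simp add: entry_mult[OF finite_reach order_refl])
qed (simp_all add: entry_zero entry_relator entry_add entry_scale)

text \<open>
  The diagonal entry of \<open>a = a\<^sup>*a\<close> in column \<open>x\<close> is \<open>\<Sum>z. \<bar>a\<^sub>z\<^sub>x\<bar>\<^sup>2\<close>, and this sum contains the square of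
  that entry itself, as the definition of a kind ring requires.
\<close>

lemma projection_entry:
  assumes "conj_subring R" "kind R" "a \<in> free R E"
    and "a * a - a \<in> rel_ideal R E" "free_star a - a \<in> rel_ideal R E" "y \<noteq> x"
  shows "entry a y x = 0"
proof (cases "y \<in> reach a x")
  case True
  \<comment> \<open>The set \<open>reach a x\<close> need not contain \<open>x\<close>, but kindness needs the diagonal entry as a summand.\<close>
  let ?Y = "insert x (reach a x)"
  have adj: "entry a x z = cnj (entry a z x)" for z
    using entry_rel_ideal[OF assms(5), of x z] by (simp add: entry_diff entry_star)
  have "entry a x x = entry (a * a) x x"
    using entry_rel_ideal[OF assms(4), of x x] by (simp add: entry_diff)
  also have "\<dots> = (\<Sum>z\<in>?Y. entry a x z * entry a z x)"
    by (intro entry_mult) (auto simp: finite_reach)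
  also have "\<dots> = of_real (\<Sum>z\<in>?Y. (cmod (entry a z x))\<^sup>2)"
    unfolding of_real_sum
    by (intro sum.cong refl) (subst adj, simp only: complex_norm_square mult.commute)
  finally show ?thesis
    using True assms(6) finite_reach
    by (intro kind_sum[OF assms(2), of ?Y x "\<lambda>z. entry a z x"] entry_in[OF assms(1,3)]) auto
qed (rule entry_outside_reach)

definition along :: "'e list \<Rightarrow> 'x \<Rightarrow> 'x" where
  "along p x = foldr shift p x"

lemma along_simps [simp]: "along [] x = x" "along (e # p) x = shift e (along p x)"
  by (simp_all add: along_def)

lemma along_in:
  assumes "awalk u p w" "x \<in> X" "src x = w"
  shows "along p x \<in> X \<and> src (along p x) = u \<and> deg (along p x) = deg x + length p"
  using assms(1)
proof (induction p arbitrary: u)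
  case (Cons e p)
  then have "e \<in> arcs E" "u = tail E e" "awalk (head E e) p w" by (auto simp: walk_Cons)
  then show ?case using Cons.IH[of "head E e"] shift_in[of e "along p x"] by auto
qed (use assms in \<open>auto simp: walk_Nil\<close>)

text \<open>Unique factorisation: two initial segments of the same path are comparable.\<close>

lemma along_eqD:
  assumes "awalk u p w" "x \<in> X" "src x = w" "awalk u' q w'" "y \<in> X" "src y = w'"
    and "along p x = along q y" "length p \<le> length q"
  shows "\<exists>r. q = p @ r \<and> x = along r y \<and> awalk w r w'"
  using assms(1,4,7,8)
proof (induction p arbitrary: q u u')
  case Nil
  then show ?case using assms(3) along_in[OF Nil(2) assms(5,6)] by (auto simp: walk_Nil)
next
  case (Cons e p)
  then obtain f q' where q: "q = f # q'" by (cases q) auto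
  have e: "e \<in> arcs E" "awalk (head E e) p w" and f: "f \<in> arcs E" "awalk (head E f) q' w'"
    using Cons.prems q by (auto simp: walk_Cons)
  have "e = f \<and> along p x = along q' y"
    using along_in[OF e(2) assms(2,3)] along_in[OF f(2) assms(5,6)] Cons.prems(3) q e(1) f(1)
    by (intro shift_inj) auto
  then show ?case using Cons.IH[OF e(2) f(2)] Cons.prems(4) q by auto
qed

end

section \<open>Finite paths with a chosen tail\<close>

text \<open>
  A branching system on paths usually consists of the infinite paths and the finite paths that end
  at a vertex that is not regular. Fewer paths suffice. Choose an edge out of every regular vertex, and
  continue every finite path by chosen edges for as long as its end is regular. The paths so obtained
  are closed under prepending and removing edges, and each is coded by the finite path that
  remains after all trailing chosen edges are removed. Prepending a chosen edge to a code of length 0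
  therefore changes the vertex but adds no edge. The third component is a free integer, the degree.
\<close>

context wf_digraph
begin

definition chosen :: "'b \<Rightarrow> bool" where
  "chosen e \<longleftrightarrow> regular G (tail G e) \<and> e = (SOME f. f \<in> out_arcs G (tail G e))"

definition tailed_paths :: "('a \<times> 'b list \<times> int) set" where
  "tailed_paths = {(v, p, k). (\<exists>w. awalk v p w) \<and> (p \<noteq> [] \<longrightarrow> \<not> chosen (last p))}"

fun prepend :: "'b \<Rightarrow> 'a \<times> 'b list \<times> int \<Rightarrow> 'a \<times> 'b list \<times> int" where
  "prepend e (v, p, k) = (tail G e, if p = [] \<and> chosen e then [] else e # p, k + 1)"

lemma chosen_exists:
  assumes "regular G v"
  obtains e where "e \<in> arcs G" "tail G e = v" "chosen e"
proof -
  define e where "e = (SOME f. f \<in> out_arcs G v)"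
  have "\<exists>f. f \<in> out_arcs G v" using assms by (auto simp: regular_def)
  then have "e \<in> out_arcs G v" unfolding e_def by (rule someI_ex)
  moreover from this have "chosen e" using assms by (simp add: chosen_def e_def)
  ultimately show ?thesis using that by auto
qed

lemma chosen_unique: "chosen e \<Longrightarrow> chosen f \<Longrightarrow> tail G e = tail G f \<Longrightarrow> e = f"
  unfolding chosen_def by metis

lemma tailed_paths_branching:
  "graded_branching_system G tailed_paths fst prepend (\<lambda>x. snd (snd x))"
proof
  show "prepend e x \<in> tailed_paths \<and> fst (prepend e x) = tail G e \<and>
      snd (snd (prepend e x)) = snd (snd x) + 1"
    if "e \<in> arcs G" "x \<in> tailed_paths" "fst x = head G e" for e x
    using that by (cases x) (auto simp: tailed_paths_def ex_walk)
  show "e = f \<and> x = y"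
    if "e \<in> arcs G" "x \<in> tailed_paths" "fst x = head G e"
      "f \<in> arcs G" "y \<in> tailed_paths" "fst y = head G f" "prepend e x = prepend f y" for e x f y
    using that chosen_unique[of e f] by (cases x; cases y) (auto split: if_splits)
  show "\<exists>e\<in>arcs G. \<exists>y\<in>tailed_paths. fst y = head G e \<and> x = prepend e y"
    if x: "x \<in> tailed_paths" "regular G (fst x)" for x
  proof -
    obtain v p k w where p: "x = (v, p, k)" "awalk v p w" "p \<noteq> [] \<longrightarrow> \<not> chosen (last p)"
      using x(1) by (auto simp: tailed_paths_def)
    show ?thesis
    proof (cases p)
      case Nil
      obtain e where e: "e \<in> arcs G" "tail G e = v" "chosen e"
        using chosen_exists x(2) p(1) by auto
      then have "(head G e, [], k - 1) \<in> tailed_paths" by (auto simp: tailed_paths_def ex_walk)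
      then show ?thesis using e Nil p(1) by (intro bexI[of _ e] bexI[of _ "(head G e, [], k - 1)"]) auto
    next
      case (Cons e q)
      then have "e \<in> arcs G" "v = tail G e" "(head G e, q, k - 1) \<in> tailed_paths"
        using p by (auto simp: tailed_paths_def ex_walk walk_Cons walk_Nil split: if_splits)
      then show ?thesis
        using Cons p by (intro bexI[of _ e] bexI[of _ "(head G e, q, k - 1)"]) auto
    qed
  qed
  show "\<exists>x\<in>tailed_paths. fst x = v \<and>
      (regular G v \<or> (\<forall>e\<in>arcs G. \<forall>y\<in>tailed_paths. fst y = head G e \<longrightarrow> x \<noteq> prepend e y))"
    if "v \<in> verts G" for v
  proof (rule bexI[of _ "(v, [], 0)"])
    \<comment> \<open>A code of length 0 can only come from a chosen edge, and such an edge starts at a regular vertex.\<close>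
    show "(v, [], 0) \<in> tailed_paths" using that by (simp add: tailed_paths_def ex_walk)
    show "fst (v, [], 0) = v \<and> (regular G v \<or>
        (\<forall>e\<in>arcs G. \<forall>y\<in>tailed_paths. fst y = head G e \<longrightarrow> (v, [], 0) \<noteq> prepend e y))"
      by (auto simp: chosen_def split: if_splits)
  qed
qed

end

section \<open>Elements with a diagonal matrix\<close>

context graded_branching_system
begin

lemma run_edges:
  assumes "awalk u p w" "z \<in> X" "src z = w"
  shows "run (map Edge p) z y \<longleftrightarrow> y = along p z"
  using assms(1)
proof (induction p arbitrary: u y)
  case (Cons e p)
  then have e: "e \<in> arcs E" "awalk (head E e) p w" by (simp_all add: walk_Cons)
  then show ?case using Cons.IH[OF e(2)] along_in[OF e(2) assms(2,3)] by simp
qed auto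

text \<open>The product \<open>\<mu>\<nu>\<^sup>*\<close> acts as \<open>\<nu>z \<mapsto> \<mu>z\<close>.\<close>

lemma run_path_ghost:
  assumes "(p, w, q) \<in> path_pairs"
  shows "run (path_ghost (p, w, q)) x y \<longleftrightarrow> (\<exists>z\<in>X. src z = w \<and> x = along q z \<and> y = along p z)"
proof -
  obtain u v where walks: "awalk u p w" "awalk v q w" using assms by (auto simp: path_pairs_def)
  have ghosts: "run (rev (map Ghost q)) x z \<longleftrightarrow> run (map Edge q) z x" for z
    using run_star[of "map Edge q" x z] by (simp add: comp_def)
  have "run (path_ghost (p, w, q)) x y \<longleftrightarrow>
      (\<exists>z. run (map Edge q) z x \<and> z \<in> X \<and> src z = w \<and> run (map Edge p) z y)"
    by (auto simp: path_ghost_def run_append ghosts)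
  then show ?thesis using run_edges[OF walks(1)] run_edges[OF walks(2)] by auto
qed

lemma entry_lincomb:
  "entry (lincomb f) y x =
    (\<Sum>t\<in>Poly_Mapping.keys f. Poly_Mapping.lookup f t * of_bool (run (path_ghost t) x y))"
  by (simp only: lincomb_def entry_sum entry_scale entry_mon)

lemma along_same_length:
  assumes "awalk u p w" "x \<in> X" "src x = w" "awalk u' q w'" "y \<in> X" "src y = w'"
    and "along p x = along q y" "length p = length q"
  shows "p = q \<and> x = y"
  using along_eqD[OF assms(1-7)] assms(8) by auto

text \<open>
  The coefficient of \<open>\<mu>\<nu>\<^sup>*\<close> with \<open>\<mu> \<noteq> \<nu>\<close> is the entry in row \<open>\<mu>z\<close> and column \<open>\<nu>z\<close>, where \<open>z\<close>
  starts at the range of \<open>\<nu>\<close> and, if that range is not regular, does not begin with an edge. Suppose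
  that \<open>\<mu>'\<nu>'\<^sup>*\<close> contributes to this entry as well. If \<open>\<nu>'\<close> is shorter than \<open>\<nu>\<close>, then \<open>\<mu>' = \<nu>'\<close> by
  induction, and the contribution would lie on the diagonal. If \<open>\<nu>'\<close> has the same length, then
  \<open>\<nu>' = \<nu>\<close>, and comparing degrees gives \<open>\<mu>' = \<mu>\<close>. If \<open>\<nu>'\<close> is longer, then \<open>\<nu>\<close> has length less than
  \<open>N\<close>, so its range is not regular, but \<open>z\<close> begins with an edge of \<open>\<nu>'\<close>.
\<close>

lemma lincomb_diagonal:
  assumes f: "Poly_Mapping.keys f \<subseteq> cut_pairs N"
    and diag: "\<And>x y. y \<noteq> x \<Longrightarrow> entry (lincomb f) y x = 0"
  shows "(p, w, q) \<in> Poly_Mapping.keys f \<Longrightarrow> p = q"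
proof (induction "length q" arbitrary: p w q rule: less_induct)
  case less
  have pairs: "t \<in> path_pairs" if "t \<in> Poly_Mapping.keys f" for t
    using f that by (auto simp: cut_pairs_def)
  obtain u v where walks: "awalk u p w" "awalk v q w"
    using pairs[OF less.prems] by (auto simp: path_pairs_def)
  obtain z where z: "z \<in> X" "src z = w"
    and root: "regular E w \<or> (\<forall>e\<in>arcs E. \<forall>y\<in>X. src y = head E e \<longrightarrow> z \<noteq> shift e y)"
    using fibre[OF walk_end[OF walks(1)]] by blast
  note p_in = along_in[OF walks(1) z] and q_in = along_in[OF walks(2) z]
  show ?case
  proof (rule ccontr)
    assume "p \<noteq> q"
    have off: "along p z \<noteq> along q z"
    proof
      assume eq: "along p z = along q z"
      then have "length p = length q" using p_in q_in by simp
      with eq \<open>p \<noteq> q\<close> show False using along_same_length[OF walks(1) z walks(2) z] by blast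
    qed
    have only: "t = (p, w, q)"
      if t: "t \<in> Poly_Mapping.keys f" and run: "run (path_ghost t) (along q z) (along p z)" for t
    proof -
      obtain p' w' q' where t': "t = (p', w', q')" by (cases t) auto
      have mem: "(p', w', q') \<in> path_pairs" using pairs[OF t] t' by simp
      obtain u' v' where walks': "awalk u' p' w'" "awalk v' q' w'"
        using mem by (auto simp: path_pairs_def)
      obtain z' where z': "z' \<in> X" "src z' = w'" and eq: "along q z = along q' z'" "along p z = along p' z'"
        using run unfolding t' run_path_ghost[OF mem] by blast
      consider "length q' < length q" | "length q' = length q" | "length q < length q'" by linarith
      then show ?thesis
      proof cases
        case 1
        then have "p' = q'" using less.hyps t t' by blast
        then show ?thesis using eq off by simp
      next
        case 2
        then have q: "q = q'" "z = z'" using along_same_length[OF walks(2) z walks'(2) z' eq(1)] by auto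
        have "length p = length p'" using p_in along_in[OF walks'(1) z'] eq(2) q by simp
        then have "p = p'" using along_same_length[OF walks(1) z walks'(1) z' eq(2)] by simp
        then show ?thesis using q z z' t' by simp
      next
        case 3
        then obtain r where r: "q' = q @ r" "z = along r z'" "awalk w r w'"
          using along_eqD[OF walks(2) z walks'(2) z' eq(1)] by auto
        with 3 obtain e s where s: "r = e # s" by (cases r) auto
        have e: "e \<in> arcs E" "awalk (head E e) s w'" using r(3) s by (simp_all add: walk_Cons)
        have "length q' \<le> N" using f t t' by (auto simp: cut_pairs_def)
        then have "\<not> regular E w" using f less.prems 3 by (auto simp: cut_pairs_def)
        then show ?thesis using root r(2) s e(1) along_in[OF e(2) z'] by auto
      qed
    qed
    have run: "run (path_ghost (p, w, q)) (along q z) (along p z)"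
      using run_path_ghost[OF pairs[OF less.prems]] z by blast
    have "0 = entry (lincomb f) (along p z) (along q z)" using diag[OF off] by simp
    also have "\<dots> = (\<Sum>t\<in>Poly_Mapping.keys f. if t = (p, w, q) then Poly_Mapping.lookup f t else 0)"
      unfolding entry_lincomb
    proof (intro sum.cong refl)
      fix t assume "t \<in> Poly_Mapping.keys f"
      then show "Poly_Mapping.lookup f t * of_bool (run (path_ghost t) (along q z) (along p z)) =
          (if t = (p, w, q) then Poly_Mapping.lookup f t else 0)"
        using only[of t] run by (cases "t = (p, w, q)") auto
    qed
    also have "\<dots> = Poly_Mapping.lookup f (p, w, q)"
      using less.prems by (simp only: sum.delta finite_keys if_True)
    finally show False using less.prems by (simp add: in_keys_iff)
  qed
qed

end

section \<open>Projections are diagonal\<close>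

context leavitt_path_algebra
begin

text \<open>
  The matrix is a function of the class modulo the relations, so the matrix of a projection
  can be compared with that of its normal form.
\<close>

lemma projection_in_spanned:
  assumes "kind R" "a \<in> free R E" "a * a \<approx> a" "free_star a \<approx> a"
  shows "a \<in> spanned diagonal_pairs"
proof -
  interpret tailed: graded_branching_system E tailed_paths fst prepend "\<lambda>x. snd (snd x)"
    by (rule tailed_paths_branching)
  obtain N where "a \<in> spanned (cut_pairs N)" using free_in_span_cut[OF assms(2)] .
  then obtain f where f: "Poly_Mapping.keys f \<subseteq> cut_pairs N" "\<forall>t. Poly_Mapping.lookup f t \<in> R"
    "a \<approx> lincomb f" unfolding spanned_def by blast
  have "tailed.entry (lincomb f) y x = 0" if "y \<noteq> x" for x y
  proof -
    have "tailed.entry a y x = 0"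
      using assms that unfolding cong_def by (intro tailed.projection_entry[OF R])
    then show ?thesis
      using tailed.entry_rel_ideal[OF f(3)[unfolded cong_def], of y x] by (simp add: tailed.entry_diff)
  qed
  then have "p = q" if "(p, w, q) \<in> Poly_Mapping.keys f" for p w q
    using tailed.lincomb_diagonal[OF f(1)] that by blast
  then have "Poly_Mapping.keys f \<subseteq> diagonal_pairs"
    using f(1) by (auto simp: diagonal_pairs_def cut_pairs_def)
  then show ?thesis using f(2,3) by (intro spannedI) blast+
qed

lemma free_star_path_ghost: "free_star (mon (path_ghost (p, w, q))) = mon (path_ghost (q, w, p))"
  by (simp add: free_star_mon path_ghost_def rev_map comp_def)

text \<open>This is \<open>\<mu>\<^sup>*\<mu> = r(\<mu>)\<close>, multiplied by \<open>\<nu>\<^sup>*\<close> from the right.\<close>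

lemma ghost_path_cancel:
  assumes "awalk u p w" "awalk v q w"
  shows "mon (rev (map Ghost p) @ path_ghost (p, w, q)) \<approx> mon (path_ghost ([], w, q))"
  using assms(1)
proof (induction p arbitrary: u)
  case (Cons e p)
  then have e: "e \<in> arcs E" "awalk (head E e) p w" by (simp_all add: walk_Cons)
  have pair: "(p, w, q) \<in> path_pairs" using e(2) assms(2) by (auto simp: path_pairs_def)
  have g: "set (rev (map Ghost p)) \<subseteq> gens E" "set (path_ghost (p, w, q)) \<subseteq> gens E"
    using walk_arcs[OF e(2)] path_pairs_gens[OF pair] by auto
  have "mon (rev (map Ghost (e # p)) @ path_ghost (e # p, w, q)) \<approx>
      mon (rev (map Ghost p) @ Vert (head E e) # path_ghost (p, w, q))"
    using mon_cong[OF word_relations(4)[OF e(1)] g] by (simp add: path_ghost_Cons)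
  also have "\<dots> \<approx> mon (rev (map Ghost p) @ path_ghost (p, w, q))"
    using mon_cong[OF _ g(1), of "Vert (head E e) # path_ghost (p, w, q)" "path_ghost (p, w, q)" "[]"]
      vertex_path_ghost[OF pair e(2), of "head E e"] e(1) by simp
  also have "\<dots> \<approx> mon (path_ghost ([], w, q))" by (rule Cons.IH[OF e(2)])
  finally show ?case .
qed (simp add: cong_refl)

lemma path_ghost_idempotent:
  assumes "awalk u p w"
  shows "mon (path_ghost (p, w, p)) * mon (path_ghost (p, w, p)) \<approx> mon (path_ghost (p, w, p))"
proof -
  have g: "set (map Edge p @ [Vert w]) \<subseteq> gens E" "set (map Edge p) \<subseteq> gens E"
    "set (rev (map Ghost p)) \<subseteq> gens E"
    using walk_arcs[OF assms] walk_end[OF assms] by auto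
  have "mon (path_ghost (p, w, p)) * mon (path_ghost (p, w, p)) \<approx>
      mon ((map Edge p @ [Vert w]) @ path_ghost ([], w, p))"
    using mon_cong[OF ghost_path_cancel[OF assms assms] g(1), of "[]"]
    by (simp add: mon_mult) (simp add: path_ghost_def)
  also have "\<dots> \<approx> mon (path_ghost (p, w, p))"
    using mon_cong[OF word_relations(1)[OF walk_end[OF assms]] g(2,3)] by (simp add: path_ghost_def)
  finally show ?thesis .
qed

text \<open>
  The generators of the diagonal are given as products of two path words, without the range in the
  middle; for a path of length 0 this product has the vertex twice.
\<close>

lemma path_times_star:
  assumes "awalk v p w"
  shows "mon (path_word v p) * free_star (mon (path_word v p)) \<approx> mon (path_ghost (p, w, p))"
proof (cases p rule: rev_cases)
  case Nil
  then show ?thesis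
    using word_relations(1)[of w] assms
    by (simp add: path_word_def path_ghost_def walk_Nil free_star_mon mon_mult)
next
  case (snoc p' e)
  have e: "e \<in> arcs E" "head E e = w" using assms snoc by (auto simp: walk_Cons walk_Nil)
  have g: "set (map Edge p') \<subseteq> gens E" "set (rev (map Ghost p)) \<subseteq> gens E"
    using walk_arcs[OF assms] snoc by auto
  show ?thesis
    using mon_cong[OF cong_sym[OF word_relations(6)[OF e(1)]] g] e(2) snoc
    by (simp add: path_word_def path_ghost_def free_star_mon mon_mult rev_map comp_def)
qed

lemma cls_cong: "a \<approx> b \<Longrightarrow> cls R E a = cls R E b"
  unfolding cong_def by (rule cls_eqI[OF R])

lemma diagonal_generator:
  assumes "awalk v p w"
  shows "mul (leavitt R E) (path_elt R E v p) (str (leavitt R E) (path_elt R E v p)) =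
    cls R E (mon (path_ghost (p, w, p)))"
  using path_word_free[OF R assms] cls_cong[OF path_times_star[OF assms]]
  by (simp add: path_elt_def leavitt_star[OF R] leavitt_mult[OF R] free_free_star[OF R])

lemma path_ghost_free: "t \<in> path_pairs \<Longrightarrow> mon (path_ghost t) \<in> free R E"
  using path_pairs_gens by (intro free_mon[OF R]) (auto simp: path_ghost_def split: prod.splits)

lemma cls_spanned_in_diagonal:
  assumes "a \<in> spanned diagonal_pairs"
  shows "cls R E a \<in> diagonal R E"
proof -
  obtain f where f: "Poly_Mapping.keys f \<subseteq> diagonal_pairs" "\<forall>t. Poly_Mapping.lookup f t \<in> R"
    "a \<approx> lincomb f" using assms unfolding spanned_def by blast
  have "cls R E (\<Sum>t\<in>A. scale (Poly_Mapping.lookup f t) (mon (path_ghost t))) \<in> diagonal R E"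
    if "finite A" "A \<subseteq> diagonal_pairs" for A
    using that
  proof (induction A rule: finite_induct)
    case empty
    have "zer (leavitt R E) \<in> diagonal R E" unfolding diagonal_def by (rule lin_span.zer)
    then show ?case by (simp add: leavitt_def)
  next
    case (insert t A)
    let ?c = "Poly_Mapping.lookup f t"
      and ?b = "\<Sum>t\<in>A. scale (Poly_Mapping.lookup f t) (mon (path_ghost t))"
    obtain p w v where t: "t = (p, w, p)" "awalk v p w"
      using insert.prems by (auto simp: diagonal_pairs_def path_pairs_def)
    have free: "mon (path_ghost t) \<in> free R E" "?b \<in> free R E"
      using insert.prems f(2)
      by (auto simp: diagonal_pairs_def intro!: path_ghost_free free_sum[OF R] free_scale[OF R])
    have "cls R E ?b \<in> diagonal R E" using insert by simp
    moreover have "cls R E (mon (path_ghost t)) \<in>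
        {mul (leavitt R E) (path_elt R E v p) (str (leavitt R E) (path_elt R E v p)) | v p w. awalk v p w}"
      using diagonal_generator[OF t(2), symmetric] t by blast
    ultimately have "add (leavitt R E) (scl (leavitt R E) ?c (cls R E (mon (path_ghost t)))) (cls R E ?b)
        \<in> diagonal R E"
      unfolding diagonal_def by (intro lin_span.step f(2)[rule_format])
    then show ?case
      using insert.hyps free f(2)
      by (simp add: leavitt_scale[OF R] leavitt_add[OF R] free_scale[OF R])
  qed
  from this[OF finite_keys f(1)] show ?thesis
    using cls_cong[OF f(3)] by (simp add: lincomb_def)
qed

end

text \<open>
  The span that defines the diagonal adds one generator at a time, whereas the image of a generator is
  some linear combination. The induction over the span therefore goes through \<open>spanned\<close>, which is
  closed under all linear operations.
\<close>

theorem corollary5: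
  fixes E :: "('v, 'e) pre_digraph" and F :: "('w, 'f) pre_digraph"
    and R :: "complex set"
    and \<pi> :: "('v, 'e) free_alg set \<Rightarrow> ('w, 'f) free_alg set"
  assumes "wf_digraph E" and "wf_digraph F"
    and "conj_subring R" and "kind R"
    and "star_algebra_hom R (leavitt R E) (leavitt R F) \<pi>"
  shows "\<pi> ` diagonal R E \<subseteq> diagonal R F"
proof -
  interpret E: leavitt_path_algebra E R
    using assms(1,3) by (simp add: leavitt_path_algebra_def leavitt_path_algebra_axioms_def)
  interpret F: leavitt_path_algebra F R
    using assms(2,3) by (simp add: leavitt_path_algebra_def leavitt_path_algebra_axioms_def)
  note R = assms(3)
  let ?A = "leavitt R E" and ?B = "leavitt R F"
  let ?D = "free R F \<inter> F.spanned F.diagonal_pairs"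
  have carr: "carr ?A = cls R E ` free R E" "carr ?B = cls R F ` free R F"
    by (simp_all add: leavitt_def)
  have \<pi>_carr: "\<exists>b\<in>free R F. \<pi> x = cls R F b" if "x \<in> carr ?A" for x
    using assms(5) that unfolding star_algebra_hom_def carr(2) by blast
  have \<pi>: "\<And>x y. x \<in> carr ?A \<Longrightarrow> y \<in> carr ?A \<Longrightarrow> \<pi> (add ?A x y) = add ?B (\<pi> x) (\<pi> y)"
    "\<And>c x. c \<in> R \<Longrightarrow> x \<in> carr ?A \<Longrightarrow> \<pi> (scl ?A c x) = scl ?B c (\<pi> x)"
    "\<And>x y. x \<in> carr ?A \<Longrightarrow> y \<in> carr ?A \<Longrightarrow> \<pi> (mul ?A x y) = mul ?B (\<pi> x) (\<pi> y)"
    "\<And>x. x \<in> carr ?A \<Longrightarrow> \<pi> (str ?A x) = str ?B (\<pi> x)"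
    using assms(5) unfolding star_algebra_hom_def by blast+
  have generator: "\<exists>b\<in>?D. \<pi> (cls R E (mon (path_ghost (p, w, p)))) = cls R F b"
    if walk: "E.awalk v p w" for v p w
  proof -
    let ?a = "mon (path_ghost (p, w, p)) :: ('v, 'e) free_alg"
    have a: "?a \<in> free R E" using walk by (intro E.path_ghost_free) (auto simp: E.path_pairs_def)
    then have aA: "cls R E ?a \<in> carr ?A" by (simp add: carr)
    then obtain b where b: "b \<in> free R F" "\<pi> (cls R E ?a) = cls R F b" using \<pi>_carr by blast
    have "mul ?A (cls R E ?a) (cls R E ?a) = cls R E ?a"
      using leavitt_mult[OF R a a] E.cls_cong[OF E.path_ghost_idempotent[OF walk]] by simp
    then have "cls R F (b * b) = cls R F b"
      using \<pi>(3)[OF aA aA] leavitt_mult[OF R b(1) b(1)] b(2) by simp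
    then have idem: "F.cong (b * b) b"
      unfolding F.cong_def using cls_eq_iff[OF R free_mult[OF R b(1) b(1)]] by blast
    have "str ?A (cls R E ?a) = cls R E ?a"
      using leavitt_star[OF R a] by (simp add: E.free_star_path_ghost)
    then have "cls R F (free_star b) = cls R F b"
      using \<pi>(4)[OF aA] leavitt_star[OF R b(1)] b(2) by simp
    then have "F.cong (free_star b) b"
      unfolding F.cong_def using cls_eq_iff[OF R free_free_star[OF R b(1)]] by blast
    with idem b show ?thesis using F.projection_in_spanned[OF assms(4) b(1)] by blast
  qed
  have "x \<in> carr ?A \<and> (\<exists>b\<in>?D. \<pi> x = cls R F b)" if "x \<in> diagonal R E" for x
    using that unfolding diagonal_def
  proof induction
    case zer
    have zero: "cls R E 0 \<in> carr ?A" unfolding carr by (intro imageI free_zero[OF R])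
    obtain b where b: "b \<in> free R F" "\<pi> (cls R E 0) = cls R F b" using \<pi>_carr[OF zero] by blast
    \<comment> \<open>Preservation of zero follows from linearity, applied to the scalar \<open>0\<close>.\<close>
    have "cls R E 0 = scl ?A 0 (cls R E 0)"
      using leavitt_scale[OF R conj_subringD(2)[OF R] free_zero[OF R], of E]
      by (simp add: scale_zero_left)
    then have "\<pi> (cls R E 0) = scl ?B 0 (cls R F b)"
      using \<pi>(2)[OF conj_subringD(2)[OF R] zero] b(2) by simp
    also have "\<dots> = cls R F 0"
      using leavitt_scale[OF R conj_subringD(2)[OF R] b(1)] by (simp add: scale_zero_left)
    finally show ?case
      using zero free_zero[OF R] F.spanned_zero by (auto simp: leavitt_def)
  next
    case (step c s x)
    obtain v p w where walk: "E.awalk v p w"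
      and "s = mul ?A (path_elt R E v p) (str ?A (path_elt R E v p))"
      using step.hyps(2) by blast
    then have s: "s = cls R E (mon (path_ghost (p, w, p)))" by (simp add: E.diagonal_generator)
    have a: "mon (path_ghost (p, w, p)) \<in> free R E"
      using walk by (intro E.path_ghost_free) (auto simp: E.path_pairs_def)
    obtain b where b: "b \<in> ?D" "\<pi> s = cls R F b" using generator[OF walk] s by blast
    obtain a' b' where x: "a' \<in> free R E" "x = cls R E a'" "b' \<in> ?D" "\<pi> x = cls R F b'"
      using step.IH carr by auto
    have cs: "scl ?A c s = cls R E (scale c (mon (path_ghost (p, w, p))))"
      unfolding s by (rule leavitt_scale[OF R step.hyps(1) a])
    have sA: "s \<in> carr ?A" "scl ?A c s \<in> carr ?A"
      using a free_scale[OF R step.hyps(1) a] by (auto simp: s cs[unfolded s] carr)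
    have "add ?A (scl ?A c s) x \<in> carr ?A"
      using leavitt_add[OF R free_scale[OF R step.hyps(1) a] x(1)]
        free_add[OF R free_scale[OF R step.hyps(1) a] x(1)] by (simp add: cs x(2) carr)
    moreover have "\<pi> (add ?A (scl ?A c s) x) = cls R F (scale c b + b')"
      using \<pi>(1)[OF sA(2), of x] \<pi>(2)[OF step.hyps(1) sA(1)] step.IH b x
        leavitt_scale[OF R step.hyps(1), of b F] leavitt_add[OF R, of "scale c b" F b']
        free_scale[OF R step.hyps(1), of b F] by simp
    moreover have "scale c b + b' \<in> ?D"
      using b(1) x(3) step.hyps(1)
      by (auto intro: free_add[OF R] free_scale[OF R] F.spanned_add F.spanned_scale)
    ultimately show ?case by blast
  qed
  then show ?thesis using F.cls_spanned_in_diagonal by force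
qed

end
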